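(* Let $M,N$ be positive integers, $\{x\}=\{x_1,\dots,x_N\}$ and $\{y\}=\{y_1,\dots,y_N\}$. Then $$\mathbf{\tilde{B}}(x_1)\cdots\mathbf{\tilde{B}}(x_N)|0\rangle=\sum_{\tilde{\mu}\in [N,M]}2^{-\ell(\tilde{\mu})}Q_{\tilde{\mu}}\{x\}\,|\tilde{\mu}),$$ $$\langle 0|\mathbf{\tilde{C}}(x_N)\cdots\mathbf{\tilde{C}}(x_1)=\sum_{\tilde{\mu}\in [N,M]}2^{-\ell(\tilde{\mu})}Q_{\tilde{\mu}}\{x\}\,(\tilde{\mu}|,$$ $$\langle 0|\mathbf{\tilde{C}}(x_N)\cdots\mathbf{\tilde{C}}(x_1)\mathbf{\tilde{B}}(y_1)\cdots\mathbf{\tilde{B}}(y_N)|0\rangle=\sum_{\tilde{\mu}\in [N,M]}2^{-\ell(\tilde{\mu})}Q_{\tilde{\mu}}\{x\}Q_{\tilde{\mu}}\{y\},$$ where $\tilde\mu$ runs over all strict partitions inside the box $[N,M]$ of height $N$ and width $M$, i.e. with at most $N$ parts and largest part at most $M$.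
   Context: Neutral fermions $\phi_m$ ($m\in\mathbb Z$) satisfy $\{\phi_m,\phi_n\}=2(-1)^m\delta_{m+n,0}$, where $\{A,B\}=AB+BA$. The Fock space $\mathcal F_\phi$ and its dual (a right module) are generated by $|0\rangle$ and $\langle 0|$ with $\phi_m|0\rangle=\langle0|\phi_{-m}=0$ for $m<0$. For $a$ of even length in the $\phi$'s, $\langle 0|a|0\rangle$ is the vacuum expectation value determined by these relations and $\langle0|1|0\rangle=1$. For a fixed positive integer $M$: $\mathbf{\tilde B}(x)$ is the ordered product of the factors $\exp\left(\tfrac12x(-1)^j\phi_{-j+1}\phi_j\right)$, $-M+1\le j\le M$, with $j$ decreasing from left to right; $\mathbf{\tilde C}(x)$ is the ordered product of the factors $\exp\left(\tfrac12x(-1)^{i-1}\phi_{-i}\phi_{i-1}\right)$, $-M+1\le i\le M$, with $i$ decreasing from right to left. A strict partition is $\tilde\nu=(\tilde\nu_1>\cdots>\tilde\nu_\ell>0)$, $\ell=\ell(\tilde\nu)$. Put $|\tilde\nu)=\phi_{\tilde\nu_1}\phi_{\tilde\nu_2}\cdots\phi_{\tilde\nu_\ell}|0\rangle$ if $\ell$ is even and $|\tilde\nu)=\phi_{\tilde\nu_1}\phi_{\tilde\nu_2}\cdots\phi_{\tilde\nu_\ell}\phi_0|0\rangle$ if $\ell$ is odd; and $(\tilde\nu|=\langle0|\phi_{-\tilde\nu_1}\phi_{-\tilde\nu_2}\cdots\phi_{-\tilde\nu_\ell}$ if $\ell$ is even, $(\tilde\nu|=\langle0|\phi_0\phi_{-\tilde\nu_1}\phi_{-\tilde\nu_2}\cdots\phi_{-\tilde\nu_\ell}$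 if $\ell$ is odd. The Schur $Q$-polynomial, for $n\ge \ell=\ell(\tilde\nu)$, is $$Q_{\tilde\nu}(x_1,\dots,x_n)=2^{\ell}\sum_{w\in S_n/S_{n-\ell}}x_{w(1)}^{\tilde\nu_1}\cdots x_{w(\ell)}^{\tilde\nu_\ell}\prod_{1\le i\le \ell,\ i<j\le n}\frac{x_{w(i)}+x_{w(j)}}{x_{w(i)}-x_{w(j)}},$$ where $S_n$ permutes $x_1,\dots,x_n$ and $S_{n-\ell}$ permutes the last $n-\ell$ variables; $Q_{\tilde\nu}\{x\}$ means $Q_{\tilde\nu}(x_1,\dots,x_N)$.
   Formalization: The second identity is false as printed (for N=M=1 the left side is ⟨0| − x((1)|, the right side ⟨0| + x((1)|); it is proved with the extra factor (−1)^{|μ|+ℓ(ℓ−1)/2} in each summand. The first and third identities are as printed. *)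

theory Defs
  imports
    "HOL-Library.Poly_Mapping"
    "HOL-Combinatorics.Permutations"
begin

section \<open>The algebra of neutral fermions\<close>

text \<open>
  The free associative algebra on letters indexed by the integers is the monoid algebra of the
  monoid of words.  The algebra of neutral fermions is its quotient by the two-sided ideal
  generated by the anticommutation relations.
\<close>

datatype word = Word (letters: "int list")

instantiation word :: monoid_add
begin
definition zero_word :: word where "zero_word = Word []"
definition plus_word :: "word \<Rightarrow> word \<Rightarrow> word"
  where "plus_word u v = Word (letters u @ letters v)"
instance by standard (simp_all add: zero_word_def plus_word_def)
end

type_synonym 'a free_alg = "word \<Rightarrow>\<^sub>0 'a"

definition free_scalar :: "'a::field_char_0 \<Rightarrow> 'a free_alg"
  where "free_scalar c = Poly_Mapping.single 0 c"

definition free_gen :: "int \<Rightarrow> 'a::field_char_0 free_alg"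
  where "free_gen m = Poly_Mapping.single (Word [m]) 1"

definition anticomm_relator :: "int \<Rightarrow> int \<Rightarrow> 'a::field_char_0 free_alg"
  where "anticomm_relator m n =
    free_gen m * free_gen n + free_gen n * free_gen m
      - free_scalar (if m + n = 0 then 2 * (- 1) powi m else 0)"

inductive_set relation_ideal :: "'a::field_char_0 free_alg set"
  where
    zero: "0 \<in> relation_ideal"
  | relator: "u * anticomm_relator m n * v \<in> relation_ideal"
  | add: "a \<in> relation_ideal \<Longrightarrow> b \<in> relation_ideal \<Longrightarrow> a + b \<in> relation_ideal"

lemma relation_ideal_mult: "a \<in> relation_ideal \<Longrightarrow> u * a * v \<in> relation_ideal"
proof (induction rule: relation_ideal.induct)
  case (relator u' m n v')
  have "u * (u' * anticomm_relator m n * v') * v = (u * u') * anticomm_relator m n * (v' * v)"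
    by (simp add: mult.assoc)
  then show ?case by (metis relation_ideal.relator)
qed (simp_all add: algebra_simps relation_ideal.intros)

lemma relation_ideal_mult_left: "a \<in> relation_ideal \<Longrightarrow> u * a \<in> relation_ideal"
  using relation_ideal_mult[of a u 1] by simp

lemma relation_ideal_mult_right: "a \<in> relation_ideal \<Longrightarrow> a * u \<in> relation_ideal"
  using relation_ideal_mult[of a 1 u] by simp

lemma relation_ideal_uminus: "a \<in> relation_ideal \<Longrightarrow> - a \<in> relation_ideal"
  using relation_ideal_mult_left[of a "- 1"] by simp

lemma relation_ideal_diff: "a \<in> relation_ideal \<Longrightarrow> b \<in> relation_ideal \<Longrightarrow> a - b \<in> relation_ideal"
  using relation_ideal.add[of a "- b"] relation_ideal_uminus[of b] by simp

definition relation_eq :: "'a::field_char_0 free_alg \<Rightarrow> 'a free_alg \<Rightarrow> bool"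
  where "relation_eq a b \<longleftrightarrow> a - b \<in> relation_ideal"

lemma equivp_relation_eq: "equivp relation_eq"
proof (rule equivpI)
  show "reflp relation_eq"
    by (simp add: reflp_def relation_eq_def relation_ideal.zero)
  show "symp relation_eq"
    unfolding symp_def relation_eq_def using relation_ideal_uminus by (metis minus_diff_eq)
  show "transp relation_eq"
    unfolding transp_def relation_eq_def using relation_ideal.add by (metis diff_add_cancel add_diff_eq)
qed

quotient_type (overloaded) 'a fermion_alg = "'a::field_char_0 free_alg" / relation_eq
  by (rule equivp_relation_eq)

text \<open>
  The classes used here are \<^class>\<open>ring\<close> and \<^class>\<open>monoid_mult\<close> rather than \<^class>\<open>ring_1\<close>,
  since the latter would include the statement that the quotient is not the zero ring.
\<close>

instantiation fermion_alg :: (field_char_0) "{ring, monoid_mult}"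
begin

lift_definition zero_fermion_alg :: "'a fermion_alg" is 0 .
lift_definition one_fermion_alg :: "'a fermion_alg" is 1 .

lift_definition plus_fermion_alg :: "'a fermion_alg \<Rightarrow> 'a fermion_alg \<Rightarrow> 'a fermion_alg" is "(+)"
  unfolding relation_eq_def by (drule (1) relation_ideal.add) (simp add: algebra_simps)

lift_definition minus_fermion_alg :: "'a fermion_alg \<Rightarrow> 'a fermion_alg \<Rightarrow> 'a fermion_alg" is "(-)"
proof (unfold relation_eq_def)
  fix a a' b b' :: "'a free_alg"
  assume "a - a' \<in> relation_ideal" "b - b' \<in> relation_ideal"
  then have "(a - a') - (b - b') \<in> relation_ideal" by (rule relation_ideal_diff)
  then show "a - b - (a' - b') \<in> relation_ideal" by (simp add: algebra_simps)
qed

lift_definition uminus_fermion_alg :: "'a fermion_alg \<Rightarrow> 'a fermion_alg" is uminus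
  unfolding relation_eq_def by (drule relation_ideal_uminus) simp

lift_definition times_fermion_alg :: "'a fermion_alg \<Rightarrow> 'a fermion_alg \<Rightarrow> 'a fermion_alg" is "(*)"
proof (unfold relation_eq_def)
  fix a a' b b' :: "'a free_alg"
  assume "a - a' \<in> relation_ideal" "b - b' \<in> relation_ideal"
  then have "(a - a') * b + a' * (b - b') \<in> relation_ideal"
    by (intro relation_ideal.add relation_ideal_mult_left relation_ideal_mult_right)
  then show "a * b - a' * b' \<in> relation_ideal" by (simp add: algebra_simps)
qed

instance
  by standard
    (transfer; simp add: relation_eq_def algebra_simps relation_ideal.zero)+

end

lift_definition scalar :: "'a::field_char_0 \<Rightarrow> 'a fermion_alg" is free_scalar .

lift_definition \<phi> :: "int \<Rightarrow> 'a::field_char_0 fermion_alg" is free_gen .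


text \<open>From here on, lifting is from the quotient algebra, not from the free algebra.\<close>

lifting_forget fermion_alg.lifting


section \<open>The Fock space, its dual and the vacuum expectation value\<close>

inductive_set vac_annihilator :: "'a::field_char_0 fermion_alg set"
  where
    zero: "0 \<in> vac_annihilator"
  | gen: "m < 0 \<Longrightarrow> a * \<phi> m \<in> vac_annihilator"
  | add: "a \<in> vac_annihilator \<Longrightarrow> b \<in> vac_annihilator \<Longrightarrow> a + b \<in> vac_annihilator"

inductive_set covac_annihilator :: "'a::field_char_0 fermion_alg set"
  where
    zero: "0 \<in> covac_annihilator"
  | gen: "m < 0 \<Longrightarrow> \<phi> (- m) * a \<in> covac_annihilator"
  | add: "a \<in> covac_annihilator \<Longrightarrow> b \<in> covac_annihilator \<Longrightarrow> a + b \<in> covac_annihilator"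

lemma vac_annihilator_mult: "a \<in> vac_annihilator \<Longrightarrow> u * a \<in> vac_annihilator"
  by (induction rule: vac_annihilator.induct)
    (simp_all add: distrib_left vac_annihilator.intros flip: mult.assoc)

lemma covac_annihilator_mult: "a \<in> covac_annihilator \<Longrightarrow> a * u \<in> covac_annihilator"
  by (induction rule: covac_annihilator.induct)
    (simp_all add: distrib_right mult.assoc covac_annihilator.intros)

lemma vac_annihilator_uminus: "a \<in> vac_annihilator \<Longrightarrow> - a \<in> vac_annihilator"
  using vac_annihilator_mult[of a "- 1"] by simp

lemma covac_annihilator_uminus: "a \<in> covac_annihilator \<Longrightarrow> - a \<in> covac_annihilator"
  using covac_annihilator_mult[of a "- 1"] by simp

definition vac_eq :: "'a::field_char_0 fermion_alg \<Rightarrow> 'a fermion_alg \<Rightarrow> bool"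
  where "vac_eq a b \<longleftrightarrow> a - b \<in> vac_annihilator"

definition covac_eq :: "'a::field_char_0 fermion_alg \<Rightarrow> 'a fermion_alg \<Rightarrow> bool"
  where "covac_eq a b \<longleftrightarrow> a - b \<in> covac_annihilator"

lemma equivp_vac_eq: "equivp vac_eq"
proof (rule equivpI)
  show "reflp vac_eq" by (simp add: reflp_def vac_eq_def vac_annihilator.zero)
  show "symp vac_eq"
    unfolding symp_def vac_eq_def using vac_annihilator_uminus by (metis minus_diff_eq)
  show "transp vac_eq"
    unfolding transp_def vac_eq_def using vac_annihilator.add by (metis diff_add_cancel add_diff_eq)
qed

lemma equivp_covac_eq: "equivp covac_eq"
proof (rule equivpI)
  show "reflp covac_eq" by (simp add: reflp_def covac_eq_def covac_annihilator.zero)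
  show "symp covac_eq"
    unfolding symp_def covac_eq_def using covac_annihilator_uminus by (metis minus_diff_eq)
  show "transp covac_eq"
    unfolding transp_def covac_eq_def using covac_annihilator.add by (metis diff_add_cancel add_diff_eq)
qed

quotient_type (overloaded) 'a fock = "'a::field_char_0 fermion_alg" / vac_eq
  by (rule equivp_vac_eq)

quotient_type (overloaded) 'a dual_fock = "'a::field_char_0 fermion_alg" / covac_eq
  by (rule equivp_covac_eq)

instantiation fock :: (field_char_0) ab_group_add
begin

lift_definition zero_fock :: "'a fock" is 0 .

lift_definition plus_fock :: "'a fock \<Rightarrow> 'a fock \<Rightarrow> 'a fock" is "(+)"
  unfolding vac_eq_def by (drule (1) vac_annihilator.add) (simp add: algebra_simps)

lift_definition uminus_fock :: "'a fock \<Rightarrow> 'a fock" is uminus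
  unfolding vac_eq_def by (drule vac_annihilator_uminus) simp

definition minus_fock :: "'a fock \<Rightarrow> 'a fock \<Rightarrow> 'a fock" where "minus_fock a b = a + (- b)"

instance
  by standard
    ((unfold minus_fock_def)?, transfer, simp add: vac_eq_def algebra_simps vac_annihilator.zero)+

end

instantiation dual_fock :: (field_char_0) ab_group_add
begin

lift_definition zero_dual_fock :: "'a dual_fock" is 0 .

lift_definition plus_dual_fock :: "'a dual_fock \<Rightarrow> 'a dual_fock \<Rightarrow> 'a dual_fock" is "(+)"
  unfolding covac_eq_def by (drule (1) covac_annihilator.add) (simp add: algebra_simps)

lift_definition uminus_dual_fock :: "'a dual_fock \<Rightarrow> 'a dual_fock" is uminus
  unfolding covac_eq_def by (drule covac_annihilator_uminus) simp

definition minus_dual_fock :: "'a dual_fock \<Rightarrow> 'a dual_fock \<Rightarrow> 'a dual_fock"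
  where "minus_dual_fock a b = a + (- b)"

instance
  by standard
    ((unfold minus_dual_fock_def)?, transfer,
      simp add: covac_eq_def algebra_simps covac_annihilator.zero)+

end

lift_definition vac :: "'a::field_char_0 fock"  (\<open>|0\<rangle>\<close>) is 1 .

lift_definition covac :: "'a::field_char_0 dual_fock"  (\<open>\<langle>0|\<close>) is 1 .

lift_definition lact :: "'a::field_char_0 fermion_alg \<Rightarrow> 'a fock \<Rightarrow> 'a fock"  (infixr \<open>\<rhd>\<close> 75)
  is "(*)"
  unfolding vac_eq_def right_diff_distrib[symmetric] by (rule vac_annihilator_mult)

lift_definition ract :: "'a::field_char_0 dual_fock \<Rightarrow> 'a fermion_alg \<Rightarrow> 'a dual_fock"
  (infixl \<open>\<lhd>\<close> 75)
  is "(*)"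
  unfolding covac_eq_def left_diff_distrib[symmetric] by (rule covac_annihilator_mult)

text \<open>
  The vacuum expectation value of \<open>a\<close> is the scalar to which \<open>a\<close> reduces modulo
  \<open>\<phi>\<^sub>m |0\<rangle> = 0\<close> and \<open>\<langle>0| \<phi>\<^sub>-\<^sub>m = 0\<close> for \<open>m < 0\<close>; in particular it is 1 for \<open>a = 1\<close>.
  It is meaningful only for \<open>a\<close> of even length in the generators: the relations do not reduce
  \<open>\<phi>\<^sub>0\<close> to a scalar.
\<close>

definition vev :: "'a::field_char_0 fermion_alg \<Rightarrow> 'a"
  where "vev a = (THE c. \<exists>u\<in>covac_annihilator. \<exists>v\<in>vac_annihilator. a = u + scalar c + v)"


section \<open>The operators\<close>

text \<open>
  The exponential series of a nilpotent element, which has only finitely many nonzero terms.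
  (The value at an element that is not nilpotent is irrelevant.)
\<close>

definition nilp_exp :: "'a::field_char_0 fermion_alg \<Rightarrow> 'a fermion_alg"
  where "nilp_exp a = (\<Sum>k | a ^ k \<noteq> 0. scalar (1 / fact k) * a ^ k)"

definition B_op :: "nat \<Rightarrow> 'a::field_char_0 \<Rightarrow> 'a fermion_alg"
  where "B_op M x =
    prod_list (map (\<lambda>j. nilp_exp (scalar (1 / 2 * x * (- 1) powi j) * \<phi> (- j + 1) * \<phi> j))
      (rev [- int M + 1..int M]))"

definition C_op :: "nat \<Rightarrow> 'a::field_char_0 \<Rightarrow> 'a fermion_alg"
  where "C_op M x =
    prod_list (map (\<lambda>i. nilp_exp (scalar (1 / 2 * x * (- 1) powi (i - 1)) * \<phi> (- i) * \<phi> (i - 1)))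
      [- int M + 1..int M])"


section \<open>Strict partitions\<close>

definition strict_partition :: "nat list \<Rightarrow> bool"
  where "strict_partition \<nu> \<longleftrightarrow> sorted_wrt (>) \<nu> \<and> (\<forall>p\<in>set \<nu>. 0 < p)"

definition box :: "nat \<Rightarrow> nat \<Rightarrow> nat list set"
  where "box N M = {\<mu>. strict_partition \<mu> \<and> length \<mu> \<le> N \<and> (\<forall>p\<in>set \<mu>. p \<le> M)}"

definition ket :: "nat list \<Rightarrow> 'a::field_char_0 fock"
  where "ket \<nu> = prod_list (map (\<lambda>p. \<phi> (int p)) \<nu>) \<rhd>
    (if even (length \<nu>) then |0\<rangle> else \<phi> 0 \<rhd> |0\<rangle>)"

text \<open>
  The factors of \<open>bra \<nu>\<close> are in the same order as those of \<open>ket \<nu>\<close>, and not in the reverse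
  order.  With \<open>\<ell>\<close> the length of \<open>\<nu>\<close> and \<open>|\<nu>|\<close> the sum of its parts, the
  pairing of \<open>bra \<nu>\<close> with \<open>ket \<nu>\<close> is therefore \<open>(-1)^(|\<nu>| + \<ell>(\<ell>-1)/2) * 2^\<ell>\<close>.
\<close>

definition bra :: "nat list \<Rightarrow> 'a::field_char_0 dual_fock"
  where "bra \<nu> = (if even (length \<nu>) then \<langle>0| else \<langle>0| \<lhd> \<phi> 0) \<lhd>
    prod_list (map (\<lambda>p. \<phi> (- int p)) \<nu>)"


section \<open>Schur Q-polynomials\<close>

definition left_cosets :: "nat \<Rightarrow> nat \<Rightarrow> (nat \<Rightarrow> nat) set set"
  where "left_cosets n l =
    (\<lambda>w. (\<lambda>s. w \<circ> s) ` {s. s permutes {l<..n}}) ` {w. w permutes {1..n}}"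

definition Q_term :: "nat list \<Rightarrow> nat \<Rightarrow> (nat \<Rightarrow> 'a::field_char_0) \<Rightarrow> (nat \<Rightarrow> nat) \<Rightarrow> 'a"
  where "Q_term \<nu> n x w =
    (\<Prod>i\<in>{1..length \<nu>}. x (w i) ^ (\<nu> ! (i - 1))) *
    (\<Prod>i\<in>{1..length \<nu>}. \<Prod>j\<in>{i<..n}. (x (w i) + x (w j)) / (x (w i) - x (w j)))"

text \<open>
  \<^const>\<open>Q_term\<close> is constant on every coset, so that \<^const>\<open>the_elem\<close> picks its only value there.
\<close>

definition Q_formula :: "nat list \<Rightarrow> nat \<Rightarrow> (nat \<Rightarrow> 'a::field_char_0) \<Rightarrow> 'a"
  where "Q_formula \<nu> n x =
    2 ^ length \<nu> * (\<Sum>K\<in>left_cosets n (length \<nu>). the_elem (Q_term \<nu> n x ` K))"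

text \<open>
  \<^const>\<open>Q_formula\<close> can be evaluated directly only where the variables take pairwise distinct
  values (elsewhere some denominator vanishes).  The Schur Q-polynomial is the polynomial that
  agrees with it there; over an infinite field it can be identified with its polynomial function.
\<close>

inductive_set poly_fun :: "nat \<Rightarrow> ((nat \<Rightarrow> 'a::field_char_0) \<Rightarrow> 'a) set" for n :: nat
  where
    const: "(\<lambda>x. c) \<in> poly_fun n"
  | var: "1 \<le> i \<Longrightarrow> i \<le> n \<Longrightarrow> (\<lambda>x. x i) \<in> poly_fun n"
  | add: "f \<in> poly_fun n \<Longrightarrow> g \<in> poly_fun n \<Longrightarrow> (\<lambda>x. f x + g x) \<in> poly_fun n"
  | mult: "f \<in> poly_fun n \<Longrightarrow> g \<in> poly_fun n \<Longrightarrow> (\<lambda>x. f x * g x) \<in> poly_fun n"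

definition schur_Q :: "nat list \<Rightarrow> nat \<Rightarrow> (nat \<Rightarrow> 'a::field_char_0) \<Rightarrow> 'a"
  where "schur_Q \<nu> n =
    (THE q. q \<in> poly_fun n \<and> (\<forall>x. inj_on x {1..n} \<longrightarrow> q x = Q_formula \<nu> n x))"

end

theory Submission
  imports Defs "HOL-Computational_Algebra.Polynomial"
begin

text \<open>
  The Fock space and its dual are treated at once.  Both are vector spaces with linear operators
  \<open>\<psi>\<^sub>m\<close> (\<open>m\<close> an integer) satisfying the anticommutation
  relations, and a vector \<open>\<Omega>\<close> killed by all \<open>\<psi>\<^sub>m\<close> with
  \<open>m < 0\<close>: on the Fock space \<open>\<psi>\<^sub>m\<close> is the left action of
  \<open>\<phi>\<^sub>m\<close>, on the dual it is the right action of \<open>(-1)\<^sup>m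
  \<phi>\<^sub>-\<^sub>m\<close>.  The second choice turns \<open>C(x)\<close> into the operator that
  the first choice makes of \<open>B(x)\<close>, so the first two identities are two instances of one
  statement.  The sign in the second identity is what remains of the factors
  \<open>(-1)\<^sup>m\<close> and of the reversal of the product of the \<open>\<phi>\<close>'s in the
  bra vector.

  Write \<open>V(x)\<close> for the common operator.  Identify the span of \<open>\<psi>\<^sub>0,
  \<dots>, \<psi>\<^sub>M\<close> with the polynomials in \<open>t\<close> modulo
  \<open>t^(M+1)\<close>, letting \<open>\<psi>\<^sub>m\<close> be \<open>t^m\<close>.  Conjugation by
  \<open>V(x)\<close> is then multiplication by \<open>(1 + x t) / (1 - x t)\<close>
  (\<open>vertex_conj\<close>).  Let \<open>E(z)\<close> be the element \<open>z t / (1 - z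
  t)\<close>, that is, the sum of \<open>z^m \<psi>\<^sub>m\<close> over \<open>1 \<le> m \<le>
  M\<close>.  A partial fraction decomposition shows that conjugation by \<open>V(z)\<close> maps
  \<open>E(w)\<close> to a combination of \<open>E(w)\<close> and \<open>E(z)\<close>
  (\<open>vertex_E\<close>), and a direct computation gives \<open>V(z) \<Omega> = \<Omega> + E(z)
  \<psi>\<^sub>0 \<Omega>\<close>.  For pairwise distinct variables it follows by induction on their
  number that \<open>V(x\<^sub>1) \<dots> V(x\<^sub>N) \<Omega>\<close> is a sum over the subsets
  \<open>S\<close> of the index set: the term of \<open>S\<close> is the product of the
  \<open>E(x\<^sub>i)\<close>, \<open>i \<in> S\<close>, applied to \<open>\<psi>\<^sub>0^|S|
  \<Omega>\<close>, with a coefficient that is a product of ratios \<open>(x\<^sub>i + x\<^sub>j) /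
  (x\<^sub>i - x\<^sub>j)\<close> (\<open>vertex_subset_expansion\<close>).  The induction step comes
  down to one rational identity (\<open>partial_fractions_cauchy_ratio\<close>).

  Expanding every \<open>E(x\<^sub>i)\<close> into modes yields a sum over matchings of some indices
  \<open>i\<close> with distinct modes \<open>m\<close>.  The term of a matching does not depend on
  the order in which its pairs are listed, because both the operators and the ratios are
  antisymmetric.  Listing the pairs by increasing index gives the sum over subsets; listing them by
  decreasing mode collects the terms with a given strict partition, and their coefficients add up to
  the symmetrization formula that defines the \<open>Q\<close>-polynomial
  (\<open>subset_expansion_eq_sum_Q_formula\<close>).

  Coinciding variables are reached by polynomiality.  Both sides are polynomial in the variables, and
  a polynomial that vanishes at all points with distinct coordinates vanishes
  (\<open>poly_fun_eq_0\<close>).  This needs that a polynomial extending the symmetrization formula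
  exists at all: it is found as a coefficient of \<open>V(x\<^sub>1) \<dots> V(x\<^sub>N)
  |0\<rangle>\<close>, read off by pairing with a bra vector (\<open>schur_Q_box\<close>).

  For the third identity the first two are multiplied.  Bra and ket vectors are orthogonal modulo the
  two annihilators (\<open>bra_ket_reduces_to\<close>), which leaves the diagonal terms.  The vacuum
  expectation value is well defined because an explicit Fock representation on functions of sets of
  natural numbers provides a functional that kills both annihilators and takes the value 1 at 1
  (\<open>vacuum_form\<close>).
\<close>

section \<open>Modules over the neutral fermions\<close>

locale neutral_fermion_module = vector_space scale
  for scale :: "'a::field_char_0 \<Rightarrow> 'v::ab_group_add \<Rightarrow> 'v"  (infixr \<open>*s\<close> 75) +
  fixes \<psi> :: "int \<Rightarrow> 'v \<Rightarrow> 'v" and \<Omega> :: 'v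
  assumes psi_add: "\<psi> m (u + v) = \<psi> m u + \<psi> m v"
    and psi_scale: "\<psi> m (c *s v) = c *s \<psi> m v"
    and psi_anticomm:
      "\<psi> m (\<psi> n v) + \<psi> n (\<psi> m v) = (if m + n = 0 then 2 * (- 1) powi m else 0) *s v"
    and psi_vacuum: "m < 0 \<Longrightarrow> \<psi> m \<Omega> = 0"
begin

sublocale endo: vector_space_pair scale scale ..

abbreviation lin :: "('v \<Rightarrow> 'v) \<Rightarrow> bool"
  where "lin \<equiv> Vector_Spaces.linear (*s) (*s)"

lemma linI: "(\<And>u v. F (u + v) = F u + F v) \<Longrightarrow> (\<And>c v. F (c *s v) = c *s F v) \<Longrightarrow> lin F"
  by (simp add: Vector_Spaces.linear_iff vector_space_axioms)

lemmas lin_simps = endo.linear_add endo.linear_diff endo.linear_neg endo.linear_scale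
  endo.linear_sum endo.linear_0

lemma lin_psi: "lin (\<psi> m)"
  by (simp add: linI psi_add psi_scale)

lemmas psi_simps = lin_simps[OF lin_psi]

lemma psi_swap: "m + n \<noteq> 0 \<Longrightarrow> \<psi> m (\<psi> n v) = - \<psi> n (\<psi> m v)"
  using psi_anticomm[of m n v] by (simp add: eq_neg_iff_add_eq_0)

lemma double_eq_0: "v + v = (0::'v) \<Longrightarrow> v = 0"
proof -
  assume "v + v = 0"
  then have "(2::'a) *s v = 0" using scale_left_distrib[of 1 1 v] by simp
  then show "v = 0" by simp
qed

lemma psi_psi_eq_0: "m \<noteq> 0 \<Longrightarrow> \<psi> m (\<psi> m v) = 0"
  by (rule double_eq_0) (use psi_anticomm[of m m v] in simp)

lemma psi_0_psi_0: "\<psi> 0 (\<psi> 0 v) = v"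
proof -
  have "(2::'a) *s \<psi> 0 (\<psi> 0 v) = 2 *s v"
    using psi_anticomm[of 0 0 v] scale_left_distrib[of 1 1 "\<psi> 0 (\<psi> 0 v)"] by simp
  then show ?thesis by simp
qed

text \<open>
  The bilinear term squares to zero, so this is its exponential: a factor of \<open>B(x)\<close>.
\<close>

definition hop :: "'a \<Rightarrow> int \<Rightarrow> 'v \<Rightarrow> 'v"
  where "hop x j v = v + (1 / 2 * x * (- 1) powi j) *s \<psi> (- j + 1) (\<psi> j v)"

lemma lin_hop: "lin (hop x j)"
  by (rule linI) (simp_all add: hop_def psi_simps scale_right_distrib mult.commute)

text \<open>
  Exchanging the two modes of the bilinear term costs one sign from anticommutation and one from
  the power of \<open>-1\<close>.
\<close>

lemma hop_reflect: "hop x (1 - j) = hop x j"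
proof
  fix v
  have "\<psi> j (\<psi> (1 - j) v) = - \<psi> (1 - j) (\<psi> j v)" by (rule psi_swap) simp
  moreover have "(- 1 :: 'a) powi (1 - j) = - ((- 1) powi j)"
    by (simp add: power_int_diff power_int_minus_one_minus field_simps)
  ultimately show "hop x (1 - j) v = hop x j v" by (simp add: hop_def)
qed

lemma hop_psi_commute:
  assumes "m \<noteq> j - 1" and "m \<noteq> - j"
  shows "hop x j (\<psi> m v) = \<psi> m (hop x j v)"
proof -
  have "\<psi> j (\<psi> m v) = - \<psi> m (\<psi> j v)" by (rule psi_swap) (use assms in simp)
  moreover have "\<psi> (- j + 1) (\<psi> m (\<psi> j v)) = - \<psi> m (\<psi> (- j + 1) (\<psi> j v))"
    by (rule psi_swap) (use assms in simp)
  ultimately show ?thesis by (simp add: hop_def psi_simps)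
qed

text \<open>
  The mode \<open>j - 1\<close> meets its partner \<open>1 - j\<close> in the bilinear term; the
  contraction leaves \<open>\<psi>\<^sub>j\<close>, to which the factor does nothing more because
  \<open>\<psi>\<^sub>j\<close> squares to zero.
\<close>

lemma hop_psi_raise:
  assumes "j \<ge> 1"
  shows "hop x j (\<psi> (j - 1) v) = \<psi> (j - 1) (hop x j v) + x *s \<psi> j (hop x j v)"
proof -
  have 1: "\<psi> j (\<psi> (j - 1) v) = - \<psi> (j - 1) (\<psi> j v)" by (rule psi_swap) (use assms in simp)
  have 2: "\<psi> (1 - j) (\<psi> (j - 1) (\<psi> j v))
      = - \<psi> (j - 1) (\<psi> (1 - j) (\<psi> j v)) + (2 * (- 1) powi (1 - j)) *s \<psi> j v"
    using psi_anticomm[of "1 - j" "j - 1" "\<psi> j v"] by (simp add: algebra_simps)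
  have 3: "\<psi> j (\<psi> (1 - j) (\<psi> j v)) = 0"
    using psi_swap[of j "1 - j" "\<psi> j v"] psi_psi_eq_0[of j v] assms by (simp add: psi_simps)
  have 4: "(- 1 :: 'a) powi j * (- 1) powi (1 - j) = - 1"
    by (simp flip: power_int_add)
  have "hop x j (\<psi> (j - 1) v) = \<psi> (j - 1) v + (1 / 2 * x * (- 1) powi j) *s
      (\<psi> (j - 1) (\<psi> (1 - j) (\<psi> j v)) - (2 * (- 1) powi (1 - j)) *s \<psi> j v)"
    by (simp add: hop_def 1 2 psi_simps)
  also have "\<dots> = \<psi> (j - 1) (hop x j v)
      - (x * ((- 1) powi j * (- 1) powi (1 - j))) *s \<psi> j v"
    by (simp add: hop_def psi_simps scale_right_diff_distrib algebra_simps)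
  also have "\<dots> = \<psi> (j - 1) (hop x j v) + x *s \<psi> j v"
    by (simp add: 4)
  also have "\<psi> j v = \<psi> j (hop x j v)"
    by (simp add: hop_def psi_simps 3)
  finally show ?thesis .
qed

text \<open>
  The factors at \<open>j\<close> and \<open>1 - j\<close> agree (\<open>hop_reflect\<close>), so that
  passing from \<open>M\<close> to \<open>M + 1\<close> puts the same factor at both ends of the
  product.
\<close>

primrec vertex :: "'a \<Rightarrow> nat \<Rightarrow> 'v \<Rightarrow> 'v"
  where "vertex x 0 v = v"
  | "vertex x (Suc M) v = hop x (int M + 1) (vertex x M (hop x (int M + 1) v))"

lemma lin_vertex: "lin (vertex x M)"
proof (induction M)
  case (Suc M)
  then show ?case by (intro linI) (simp_all add: lin_simps[OF lin_hop] lin_simps[OF Suc.IH])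
qed (simp add: linI)

lemma foldr_hop: "foldr (hop x) (rev [- int M + 1..int M]) v = vertex x M v"
proof (induction M arbitrary: v)
  case (Suc M)
  have "[- int (Suc M) + 1..int (Suc M)] = (- int M) # [- int M + 1..int M] @ [int M + 1]"
    using upto_rec1[of "- int M" "int M + 1"] upto_rec2[of "- int M + 1" "int M + 1"]
    by (simp add: algebra_simps)
  then have "rev [- int (Suc M) + 1..int (Suc M)]
      = (int M + 1) # rev [- int M + 1..int M] @ [1 - (int M + 1)]" by simp
  then show ?case by (simp only: foldr.simps foldr_append o_apply id_apply Suc.IH vertex.simps hop_reflect)
qed simp

lemma vertex_psi_above: "int M < m \<Longrightarrow> vertex x M (\<psi> m v) = \<psi> m (vertex x M v)"
  by (induction M arbitrary: v) (simp_all add: hop_psi_commute)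

text \<open>
  In terms of the generating polynomials of \<open>c\<close> and \<open>d\<close>, the hypothesis says
  that \<open>(1 - x t) d(t)\<close> and \<open>(1 + x t) c(t)\<close> agree up to degree
  \<open>M\<close>.  The factors on the right of the product multiply by \<open>1 + x t\<close>, those
  on the left by the geometric series of \<open>x t\<close>.
\<close>

lemma vertex_conj:
  assumes "d 0 = c 0" and "\<And>n. n < M \<Longrightarrow> d (Suc n) = x * d n + (c (Suc n) + x * c n)"
  shows "vertex x M (\<Sum>m\<le>M. c m *s \<psi> (int m) v) = (\<Sum>m\<le>M. d m *s \<psi> (int m) (vertex x M v))"
  using assms(2)
proof (induction M arbitrary: v)
  case 0
  then show ?case by (simp add: assms(1))
next
  case (Suc M)
  define h where "h = hop x (int M + 1)"
  note h = lin_simps[OF lin_hop[of x "int M + 1", folded h_def]]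
  note b = lin_simps[OF lin_vertex[of x M]]
  have vertex_h: "vertex x (Suc M) u = h (vertex x M (h u))" for u by (simp add: h_def)
  have low: "h (\<Sum>m<M. e m *s \<psi> (int m) u) = (\<Sum>m<M. e m *s \<psi> (int m) (h u))" for e u
    unfolding h unfolding h_def
    by (intro sum.cong refl arg_cong[where f = "scale _"] hop_psi_commute) auto
  have mid: "h (\<psi> (int M) u) = \<psi> (int M) (h u) + x *s \<psi> (int M + 1) (h u)" for u
    using hop_psi_raise[of "int M + 1" x u] by (simp add: h_def)
  have top: "h (\<psi> (1 + int M) u) = \<psi> (1 + int M) (h u)" for u
    unfolding h_def by (rule hop_psi_commute) auto
  \<comment> \<open>the outermost factor only sees the top two modes, so its effect adds \<open>x\<close> times the
    coefficient of \<open>\<psi>\<^sub>M\<close> to that of the new mode\<close>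
  have pass: "h ((\<Sum>m\<le>M. e m *s \<psi> (int m) u) + e' *s \<psi> (int M + 1) u)
      = (\<Sum>m\<le>M. e m *s \<psi> (int m) (h u)) + (x * e M + e') *s \<psi> (int M + 1) (h u)" for e e' u
    by (simp add: lessThan_Suc_atMost[symmetric] h(1,4) low mid top algebra_simps)
  have "vertex x (Suc M) (\<Sum>m\<le>Suc M. c m *s \<psi> (int m) v)
      = h (vertex x M ((\<Sum>m\<le>M. c m *s \<psi> (int m) (h v))
          + (x * c M + c (Suc M)) *s \<psi> (int M + 1) (h v)))"
    by (simp only: vertex_h sum.atMost_Suc pass of_nat_Suc add.commute[of 1])
  also have "\<dots> = h ((\<Sum>m\<le>M. d m *s \<psi> (int m) (vertex x M (h v)))
          + (x * c M + c (Suc M)) *s \<psi> (int M + 1) (vertex x M (h v)))"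
    using Suc by (simp add: b(1,4) vertex_psi_above)
  also have "\<dots> = (\<Sum>m\<le>Suc M. d m *s \<psi> (int m) (vertex x (Suc M) v))"
    using Suc.prems[of M] unfolding pass vertex_h by (simp add: algebra_simps)
  finally show ?case .
qed

definition E :: "nat \<Rightarrow> 'a \<Rightarrow> 'v \<Rightarrow> 'v"
  where "E M z v = (\<Sum>m\<in>{1..M}. z ^ m *s \<psi> (int m) v)"

lemma E_atMost: "E M z v = (\<Sum>m\<le>M. (if m = 0 then 0 else z ^ m) *s \<psi> (int m) v)"
  unfolding E_def by (rule sum.mono_neutral_cong_left) auto

lemma lin_E: "lin (E M z)"
  by (rule linI) (simp_all add: E_def psi_simps algebra_simps sum.distrib scale_sum_right)

lemmas E_simps = lin_simps[OF lin_E]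

lemma psi_E_swap: "n \<ge> 0 \<Longrightarrow> \<psi> n (E M z v) = - E M z (\<psi> n v)"
  unfolding E_def by (simp add: psi_simps sum_negf[symmetric] psi_swap[of n])

lemma E_swap: "E M z (E M w v) = - E M w (E M z v)"
  by (subst (1 4) E_def) (simp add: psi_E_swap E_simps sum_negf)

lemma E_E: "E M z (E M z v) = 0"
  by (rule double_eq_0) (metis E_swap add.right_inverse)

text \<open>
  The partial fraction decomposition of \<open>(1 + z t) / (1 - z t) * w t / (1 - w t)\<close>, whose
  poles are at most the simple ones at \<open>1 / w\<close> and \<open>1 / z\<close>.
\<close>

lemma vertex_E:
  assumes "w \<noteq> z"
  shows "vertex z M (E M w v) = ((w + z) / (w - z)) *s E M w (vertex z M v)
    - (1 + (w + z) / (w - z)) *s E M z (vertex z M v)"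
proof -
  define r where "r = (w + z) / (w - z)"
  have r: "r * (w - z) = w + z" using assms by (simp add: r_def)
  define d where "d m = (if m = 0 then 0 else r * w ^ m - (1 + r) * z ^ m)" for m
  have "vertex z M (E M w v) = (\<Sum>m\<le>M. d m *s \<psi> (int m) (vertex z M v))"
    unfolding E_atMost
  proof (rule vertex_conj)
    fix n
    show "d (Suc n) = z * d n + ((if Suc n = 0 then 0 else w ^ Suc n) + z * (if n = 0 then 0 else w ^ n))"
    proof (cases "n = 0")
      case True
      then show ?thesis using r by (simp add: d_def algebra_simps)
    next
      case False
      have "d (Suc n) - z * d n = r * (w - z) * w ^ n"
        using False by (simp add: d_def algebra_simps)
      then show ?thesis using False unfolding r by (simp add: algebra_simps)
    qed
  qed (simp add: d_def)
  also have "\<dots> = r *s E M w (vertex z M v) - (1 + r) *s E M z (vertex z M v)"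
    unfolding E_atMost scale_sum_right sum_subtractf[symmetric]
    by (intro sum.cong) (simp_all add: d_def scale_left_diff_distrib)
  finally show ?thesis by (simp add: r_def)
qed

text \<open>
  The constant 1 is sent to \<open>(1 + z t) / (1 - z t) = 1 + 2 z t / (1 - z t)\<close>.
\<close>

lemma vertex_psi_0:
  "vertex z M (\<psi> 0 v) = \<psi> 0 (vertex z M v) + 2 *s E M z (vertex z M v)"
proof -
  have "vertex z M (\<psi> 0 v) = vertex z M (\<Sum>m\<le>M. (if m = 0 then 1 else 0) *s \<psi> (int m) v)"
    by (subst sum.delta'[where a = 0, simplified] | simp add: if_distrib[of "\<lambda>c. c *s _"] cong: if_cong)+
  also have "\<dots> = (\<Sum>m\<le>M. (if m = 0 then 1 else 2 * z ^ m) *s \<psi> (int m) (vertex z M v))"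
    by (rule vertex_conj) auto
  also have "\<dots> = (\<Sum>m\<le>M. (if m = 0 then 1 else 0) *s \<psi> (int m) (vertex z M v))
      + 2 *s E M z (vertex z M v)"
    unfolding E_atMost scale_sum_right sum.distrib[symmetric] by (intro sum.cong) auto
  also have "(\<Sum>m\<le>M. (if m = 0 then 1 else 0) *s \<psi> (int m) (vertex z M v)) = \<psi> 0 (vertex z M v)"
    by (simp add: if_distrib[of "\<lambda>c. c *s _"] cong: if_cong)
  finally show ?thesis .
qed

text \<open>
  The factors to the right of the middle pair \<open>j = 1, 0\<close> fix the vacuum, the pair adds
  \<open>z \<psi>\<^sub>1 \<psi>\<^sub>0 \<Omega>\<close>, and the factors to the left extend \<open>z
  \<psi>\<^sub>1\<close> to \<open>E(z)\<close>.
\<close>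

lemma vertex_vacuum: "vertex z M \<Omega> = \<Omega> + E M z (\<psi> 0 \<Omega>)"
proof (induction M)
  case 0
  then show ?case by (simp add: E_def)
next
  case (Suc M)
  define h where "h = hop z (int M + 1)"
  note h = lin_simps[OF lin_hop[of z "int M + 1", folded h_def]]
  show ?case
  proof (cases "M = 0")
    case True
    have "\<psi> 1 (\<psi> 0 (\<psi> 1 \<Omega>)) = 0"
      using psi_swap[of 1 0 "\<psi> 1 \<Omega>"] psi_psi_eq_0[of 1 \<Omega>] by (simp add: psi_simps)
    then have "hop z 1 (hop z 1 \<Omega>) = \<Omega> - (1/2 * z + 1/2 * z) *s \<psi> 0 (\<psi> 1 \<Omega>)"
      unfolding scale_left_distrib by (simp add: hop_def psi_simps)
    then show ?thesis using True psi_swap[of 1 0 \<Omega>] by (simp add: E_def)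
  next
    case False
    have h_vac: "h \<Omega> = \<Omega>"
      using psi_swap[of "- int M" "int M + 1" \<Omega>] psi_vacuum[of "- int M"] False
      by (simp add: h_def hop_def psi_simps)
    have h_psi0: "h (\<psi> 0 \<Omega>) = \<psi> 0 \<Omega>"
      using False unfolding h_def by (subst hop_psi_commute) (auto simp: h_vac[unfolded h_def])
    obtain k where k: "M = Suc k" using False by (cases M) auto
    have low: "h (\<psi> (int m) u) = \<psi> (int m) (h u)" if "m < M" for m u
      unfolding h_def by (rule hop_psi_commute) (use that in auto)
    have mid: "h (\<psi> (int M) u) = \<psi> (int M) (h u) + z *s \<psi> (int M + 1) (h u)" for u
      using hop_psi_raise[of "int M + 1" z u] by (simp add: h_def)
    have "h (E M z (\<psi> 0 \<Omega>)) = E (Suc M) z (\<psi> 0 \<Omega>)"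
      using mid[of "\<psi> 0 \<Omega>"] unfolding E_def k
      by (simp add: h h_psi0 low[unfolded k] algebra_simps)
    then show ?thesis using Suc by (simp add: h_def[symmetric] h_vac h)
  qed
qed

text \<open>
  The vector \<open>\<psi>\<^sub>0^n \<Omega>\<close>, which depends on the parity of \<open>n\<close>
  only because \<open>\<psi>\<^sub>0\<close> is an involution.
\<close>

definition parity_vac :: "nat \<Rightarrow> 'v"
  where "parity_vac n = (if even n then \<Omega> else \<psi> 0 \<Omega>)"

lemma vertex_parity_vac:
  "vertex z M (parity_vac n) = parity_vac n + E M z (parity_vac (Suc n))"
proof (cases "even n")
  case False
  have "vertex z M (\<psi> 0 \<Omega>) = \<psi> 0 \<Omega> + 2 *s E M z \<Omega> - E M z \<Omega>"
    by (simp add: vertex_psi_0 vertex_vacuum psi_E_swap psi_0_psi_0 E_simps E_E psi_simps)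
  then show ?thesis
    using False scale_left_distrib[of 1 1 "E M z \<Omega>"] by (simp add: parity_vac_def)
qed (simp add: parity_vac_def vertex_vacuum)

end

section \<open>Products of vertex operators on the vacuum\<close>

definition cauchy_ratio :: "('i \<Rightarrow> 'a::field) \<Rightarrow> 'i \<Rightarrow> 'i \<Rightarrow> 'a"
  where "cauchy_ratio x i j = (x i + x j) / (x i - x j)"

lemma cauchy_ratio_swap: "cauchy_ratio x j i = - cauchy_ratio x i j"
  unfolding cauchy_ratio_def by (metis add.commute minus_diff_eq minus_divide_right)

text \<open>
  The addition theorem of the hyperbolic cotangent, multiplicatively: for \<open>x\<^sub>i = exp (2
  u\<^sub>i)\<close> the ratio is \<open>coth (u\<^sub>i - u\<^sub>j)\<close>.
\<close>

lemma cauchy_ratio_three_term: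
  assumes "x a \<noteq> x b" "x a \<noteq> x c" "x b \<noteq> x c"
  shows "cauchy_ratio x a b * cauchy_ratio x b c + cauchy_ratio x b c * cauchy_ratio x c a
    + cauchy_ratio x c a * cauchy_ratio x a b = - 1"
proof -
  have "x a - x b \<noteq> 0" "x b - x c \<noteq> 0" "x c - x a \<noteq> 0" using assms by auto
  then show ?thesis unfolding cauchy_ratio_def
    by (simp add: divide_simps) (simp add: algebra_simps)
qed

text \<open>
  As functions of \<open>x\<^sub>a\<close>, both sides have at most simple poles, at the
  \<open>x\<^sub>i\<close>, with the same residues, and value 1 at infinity, since \<open>1 +
  cauchy_ratio x i a = 2 x\<^sub>i / (x\<^sub>i - x\<^sub>a)\<close>.  An induction that also uses the
  identity with the new variable in place of \<open>x\<^sub>a\<close> avoids limits and residues.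
\<close>

lemma partial_fractions_cauchy_ratio:
  assumes "finite Y" and "inj_on x (insert a Y)" and "a \<notin> Y"
  shows "(\<Prod>i\<in>Y. cauchy_ratio x a i)
    = 1 - (\<Sum>i\<in>Y. (1 + cauchy_ratio x i a) * (\<Prod>j\<in>Y - {i}. cauchy_ratio x i j))"
  using assms
proof (induction Y arbitrary: a rule: finite_induct)
  case (insert b Y)
  let ?r = "cauchy_ratio x" and ?h = "\<lambda>i. \<Prod>j\<in>Y - {i}. cauchy_ratio x i j"
  have IHa: "(\<Prod>i\<in>Y. ?r a i) = 1 - (\<Sum>i\<in>Y. (1 + ?r i a) * ?h i)"
    using insert.prems by (intro insert.IH) (auto simp: inj_on_def)
  have IHb: "(\<Prod>i\<in>Y. ?r b i) = 1 - (\<Sum>i\<in>Y. (1 + ?r i b) * ?h i)"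
    using insert.prems insert.hyps by (intro insert.IH) (auto simp: inj_on_def)
  have summand: "?r a b * ((1 + ?r i a) * ?h i)
      = (1 + ?r i a) * (\<Prod>j\<in>insert b Y - {i}. ?r i j) - (1 + ?r b a) * ((1 + ?r i b) * ?h i)"
    if "i \<in> Y" for i
  proof -
    have "insert b Y - {i} = insert b (Y - {i})" using that insert.hyps by auto
    then have "(\<Prod>j\<in>insert b Y - {i}. ?r i j) = ?r i b * ?h i"
      using insert.hyps by simp
    moreover have "x a \<noteq> x b" "x b \<noteq> x i" "x i \<noteq> x a"
      using insert.prems insert.hyps that by (auto simp: inj_on_def)
    then have "?r a b * ?r b i + ?r b i * ?r i a + ?r i a * ?r a b = - 1"
      by (intro cauchy_ratio_three_term) auto
    then have "?r a b * (1 + ?r i a) = (1 + ?r i a) * ?r i b - (1 + ?r b a) * (1 + ?r i b)"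
      using cauchy_ratio_swap[of x b a] cauchy_ratio_swap[of x b i] by algebra
    ultimately show ?thesis by (metis (no_types, opaque_lifting) left_diff_distrib mult.assoc)
  qed
  have "(\<Prod>i\<in>insert b Y. ?r a i) = ?r a b * (1 - (\<Sum>i\<in>Y. (1 + ?r i a) * ?h i))"
    using insert.hyps by (simp add: IHa)
  also have "\<dots> = ?r a b - (\<Sum>i\<in>Y. ?r a b * ((1 + ?r i a) * ?h i))"
    by (simp add: right_diff_distrib sum_distrib_left)
  also have "\<dots> = ?r a b - ((\<Sum>i\<in>Y. (1 + ?r i a) * (\<Prod>j\<in>insert b Y - {i}. ?r i j))
      - (1 + ?r b a) * (\<Sum>i\<in>Y. (1 + ?r i b) * ?h i))"
    by (simp add: summand sum_subtractf sum_distrib_left cong: sum.cong)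
  also have "(\<Sum>i\<in>Y. (1 + ?r i b) * ?h i) = 1 - (\<Prod>i\<in>Y. ?r b i)"
    by (simp add: IHb)
  also have "?r a b - ((\<Sum>i\<in>Y. (1 + ?r i a) * (\<Prod>j\<in>insert b Y - {i}. ?r i j))
      - (1 + ?r b a) * (1 - (\<Prod>i\<in>Y. ?r b i)))
    = 1 - ((1 + ?r b a) * (\<Prod>i\<in>Y. ?r b i)
        + (\<Sum>i\<in>Y. (1 + ?r i a) * (\<Prod>j\<in>insert b Y - {i}. ?r i j)))"
    by (simp add: cauchy_ratio_swap[of x b a] algebra_simps)
  also have "\<dots> = 1 - (\<Sum>i\<in>insert b Y. (1 + ?r i a) * (\<Prod>j\<in>insert b Y - {i}. ?r i j))"
    using insert.hyps by simp
  finally show ?case .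
qed simp

context neutral_fermion_module
begin

text \<open>
  The weights make the order of the letters immaterial: when the operators anticommute and the
  ratios are antisymmetric, the two signs caused by a transposition of letters cancel.
\<close>

primrec weighted_word :: "('b \<Rightarrow> 'b \<Rightarrow> 'a) \<Rightarrow> ('b \<Rightarrow> 'v \<Rightarrow> 'v) \<Rightarrow> 'b list \<Rightarrow> 'v \<Rightarrow> 'v"
  where "weighted_word r A [] v = v"
  | "weighted_word r A (b # bs) v = (\<Prod>c\<in>set bs. r b c) *s A b (weighted_word r A bs v)"

lemma weighted_word_insort_key:
  assumes "\<And>b c. r c b = - r b c" and "\<And>b. lin (A b)"
    and "\<And>b c u. b \<in> L \<Longrightarrow> c \<in> L \<Longrightarrow> A b (A c u) = - A c (A b u)"
    and "distinct (a # bs)" and "set (a # bs) \<subseteq> L"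
  shows "weighted_word r A (insort_key k a bs) v = weighted_word r A (a # bs) v"
  using assms(4,5)
proof (induction bs)
  case (Cons b bs)
  have "weighted_word r A (b # insort_key k a bs) v
      = (r b a * (\<Prod>c\<in>set bs. r b c)) *s A b (weighted_word r A (a # bs) v)"
    using Cons by (simp add: set_insort_key)
  also have "\<dots> = (r b a * (\<Prod>c\<in>set bs. r b c) * (\<Prod>c\<in>set bs. r a c)) *s
      A b (A a (weighted_word r A bs v))"
    by (simp add: lin_simps[OF assms(2)])
  also have "\<dots> = weighted_word r A (a # b # bs) v"
    using Cons.prems
    by (simp add: lin_simps[OF assms(2)] assms(1)[of b a] assms(3)[of b a] mult_ac)
  finally show ?case by simp
qed simp

lemma weighted_word_sort_key:
  assumes "\<And>b c. r c b = - r b c" and "\<And>b. lin (A b)"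
    and "\<And>b c u. b \<in> L \<Longrightarrow> c \<in> L \<Longrightarrow> A b (A c u) = - A c (A b u)"
    and "distinct bs" and "set bs \<subseteq> L"
  shows "weighted_word r A (sort_key k bs) v = weighted_word r A bs v"
  using assms(4,5)
proof (induction bs)
  case (Cons b bs)
  then show ?case
    using weighted_word_insort_key[of r A L b "sort_key k bs" k v, OF assms(1-3)] by simp
qed simp

abbreviation E_word :: "nat \<Rightarrow> ('i \<Rightarrow> 'a) \<Rightarrow> 'i list \<Rightarrow> 'v \<Rightarrow> 'v"
  where "E_word M x \<equiv> weighted_word (cauchy_ratio x) (\<lambda>i. E M (x i))"

lemma lin_E_word: "lin (E_word M x I)"
  by (rule linI; induction I) (simp_all add: E_simps scale_right_distrib mult.commute)

lemmas E_word_simps = lin_simps[OF lin_E_word]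

lemma E_word_E: "E_word M x I (E M z v) = (- 1) ^ length I *s E M z (E_word M x I v)"
  by (induction I) (simp_all add: E_simps E_swap[of M z] mult.commute)

lemma E_word_insort:
  fixes I :: "'i::linorder list"
  assumes "distinct (a # I)"
  shows "E_word M x (insort a I) v = E_word M x (a # I) v"
  using weighted_word_insort_key[where L = UNIV, OF cauchy_ratio_swap lin_E E_swap assms] by simp

text \<open>
  Each \<open>E(x\<^sub>i)\<close> is replaced by a combination of itself and
  \<open>E(x\<^sub>a)\<close>.  Since \<open>E(x\<^sub>a)\<close> squares to zero, at most one letter
  of the word can be replaced in a nonzero term; \<open>i\<close> is the index of that letter, and
  moving the new letter to the front turns the ratios to the left of position \<open>i\<close> around.
\<close>

lemma vertex_E_word:
  assumes "distinct I" and "\<And>i. i \<in> set I \<Longrightarrow> x i \<noteq> x a"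
  shows "vertex (x a) M (E_word M x I v)
    = (\<Prod>i\<in>set I. cauchy_ratio x i a) *s E_word M x I (vertex (x a) M v)
      - (\<Sum>i\<in>set I. ((1 + cauchy_ratio x i a)
          * (\<Prod>j\<in>set I - {i}. cauchy_ratio x j a * cauchy_ratio x i j))
            *s E M (x a) (E_word M x (remove1 i I) (vertex (x a) M v)))"
  using assms
proof (induction I)
  case (Cons b I)
  let ?r = "cauchy_ratio x" and ?w = "vertex (x a) M v" and ?e = "E M (x a)"
  define R where "R = (\<Prod>j\<in>set I. ?r b j)"
  define K where "K = (\<Prod>i\<in>set I. ?r i a)"
  define G where "G i = (1 + ?r i a) * (\<Prod>j\<in>set I - {i}. ?r j a * ?r i j)" for i
  have IH: "vertex (x a) M (E_word M x I v) = K *s E_word M x I ?w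
      - (\<Sum>i\<in>set I. G i *s ?e (E_word M x (remove1 i I) ?w))"
    unfolding K_def G_def using Cons by simp
  have G: "(1 + ?r i a) * (\<Prod>j\<in>set (b # I) - {i}. ?r j a * ?r i j)
      = G i * (?r b a * ?r i b)" if "i \<in> set I" for i
  proof -
    have "set (b # I) - {i} = insert b (set I - {i})" using that Cons.prems by auto
    then show ?thesis using Cons.prems by (simp add: G_def)
  qed
  have Rsplit: "R = ?r b i * (\<Prod>j\<in>set I - {i}. ?r b j)" if "i \<in> set I" for i
    unfolding R_def using that by (simp add: prod.remove)
  have "vertex (x a) M (E_word M x (b # I) v)
      = R *s (?r b a *s E M (x b) (vertex (x a) M (E_word M x I v))
          - (1 + ?r b a) *s ?e (vertex (x a) M (E_word M x I v)))"
    using Cons.prems(2)[of b]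
    by (simp add: R_def lin_simps[OF lin_vertex] vertex_E cauchy_ratio_def)
  also have "\<dots> = (R * ?r b a * K) *s E M (x b) (E_word M x I ?w)
      - (\<Sum>i\<in>set I. (R * ?r b a * G i) *s E M (x b) (?e (E_word M x (remove1 i I) ?w)))
      - (R * (1 + ?r b a) * K) *s ?e (E_word M x I ?w)"
    unfolding IH
    by (simp add: E_simps E_E scale_right_diff_distrib scale_sum_right mult.assoc)
  also have "(R * ?r b a * K) *s E M (x b) (E_word M x I ?w)
      = (\<Prod>i\<in>set (b # I). ?r i a) *s E_word M x (b # I) ?w"
    using Cons.prems by (simp add: R_def K_def mult_ac)
  also have "(\<Sum>i\<in>set I. (R * ?r b a * G i) *s E M (x b) (?e (E_word M x (remove1 i I) ?w)))
      = (\<Sum>i\<in>set I. ((1 + ?r i a) * (\<Prod>j\<in>set (b # I) - {i}. ?r j a * ?r i j))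
            *s ?e (E_word M x (remove1 i (b # I)) ?w))"
  proof (rule sum.cong[OF refl])
    fix i assume i: "i \<in> set I"
    then have ne: "i \<noteq> b" using Cons.prems by auto
    have set_rem: "set (remove1 i I) = set I - {i}" using Cons.prems by simp
    show "(R * ?r b a * G i) *s E M (x b) (?e (E_word M x (remove1 i I) ?w))
      = ((1 + ?r i a) * (\<Prod>j\<in>set (b # I) - {i}. ?r j a * ?r i j))
            *s ?e (E_word M x (remove1 i (b # I)) ?w)"
      unfolding G[OF i] Rsplit[OF i] E_swap[of M "x b" "x a"]
      using ne by (simp add: set_rem E_simps cauchy_ratio_swap[of x b i] mult_ac)
  qed
  also have "(R * (1 + ?r b a) * K) *s ?e (E_word M x I ?w)
      = ((1 + ?r b a) * (\<Prod>j\<in>set (b # I) - {b}. ?r j a * ?r b j))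
            *s ?e (E_word M x (remove1 b (b # I)) ?w)"
    using Cons.prems by (simp add: R_def K_def prod.distrib mult_ac)
  finally show ?case using Cons.prems by (simp add: algebra_simps)
qed simp

text \<open>
  For distinct variables this turns out to be the product of the \<open>V(x\<^sub>i)\<close>, \<open>i
  \<in> X\<close>, applied to \<open>\<Omega>\<close>. The summand of \<open>S\<close> does not depend
  on the order in which \<open>S\<close> is listed.
\<close>

definition subset_expansion :: "nat \<Rightarrow> ('i::linorder \<Rightarrow> 'a) \<Rightarrow> 'i set \<Rightarrow> 'v"
  where "subset_expansion M x X = (\<Sum>S\<in>Pow X. (\<Prod>i\<in>S. \<Prod>j\<in>X - S. cauchy_ratio x i j) *s
    E_word M x (sorted_list_of_set S) (parity_vac (card S)))"

lemma subset_expansion_empty: "subset_expansion M x {} = \<Omega>"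
  by (simp add: subset_expansion_def parity_vac_def)

text \<open>
  Subsets without \<open>a\<close> arise from the terms in which no \<open>E(x\<^sub>i)\<close> has
  been replaced.  A subset \<open>T \<union> {a}\<close> arises from \<open>T\<close>, by the second
  term of \<open>V(x\<^sub>a)\<close> on the vacuum, and from every \<open>T \<union> {i}\<close> by
  replacing \<open>E(x\<^sub>i)\<close>; the sum of these contributions is given by the partial
  fraction identity.
\<close>

lemma vertex_subset_expansion:
  fixes x :: "'i::linorder \<Rightarrow> 'a"
  assumes fin: "finite X" and inj: "inj_on x (insert a X)" and a: "a \<notin> X"
  shows "vertex (x a) M (subset_expansion M x X) = subset_expansion M x (insert a X)"
proof -
  let ?r = "cauchy_ratio x" and ?e = "E M (x a)"
  define g where "g S = (\<Prod>i\<in>S. \<Prod>j\<in>X - S. ?r i j)" for S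
  define W where "W S v = E_word M x (sorted_list_of_set S) v" for S v
  define p where "p S = parity_vac (card S)" for S :: "'i set"
  define q where "q S = parity_vac (Suc (card S))" for S :: "'i set"
  define c where "c i S = (1 + ?r i a) * (\<Prod>j\<in>S - {i}. ?r j a * ?r i j)" for i S
  have finS: "finite S" if "S \<in> Pow X" for S using that fin finite_subset by auto
  have W_E: "?e (W S (?e v)) = 0" for S v by (simp add: W_def E_word_E E_simps E_E)
  have step: "vertex (x a) M (g S *s W S (p S))
      = (g S * (\<Prod>i\<in>S. ?r i a)) *s W S (p S)
        + (g S * (\<Prod>i\<in>S. ?r a i)) *s ?e (W S (q S))
        - (\<Sum>i\<in>S. (g S * c i S) *s ?e (W (S - {i}) (q (S - {i}))))"
    if S: "S \<in> Pow X" for S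
  proof -
    have fS: "finite S" using finS[OF S] .
    have "vertex (x a) M (W S (p S))
        = (\<Prod>i\<in>S. ?r i a) *s W S (p S + ?e (q S))
          - (\<Sum>i\<in>S. c i S *s ?e (W (S - {i}) (p S + ?e (q S))))"
      unfolding W_def c_def
      using fS S inj a
      by (subst vertex_E_word)
        (auto simp: p_def q_def vertex_parity_vac sorted_list_of_set_remove inj_on_def)
    also have "W S (p S + ?e (q S)) = W S (p S) + (- 1) ^ card S *s ?e (W S (q S))"
      using fS by (simp add: W_def E_word_simps E_word_E)
    also have "(\<Sum>i\<in>S. c i S *s ?e (W (S - {i}) (p S + ?e (q S))))
        = (\<Sum>i\<in>S. c i S *s ?e (W (S - {i}) (q (S - {i}))))"
    proof (rule sum.cong[OF refl])
      fix i assume i: "i \<in> S"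
      have "p S = q (S - {i})"
        unfolding p_def q_def using card_Suc_Diff1[OF fS i] by simp
      then show "c i S *s ?e (W (S - {i}) (p S + ?e (q S)))
          = c i S *s ?e (W (S - {i}) (q (S - {i})))"
        using W_E[of "S - {i}" "q S"] by (simp add: W_def E_word_simps E_simps)
    qed
    finally have "vertex (x a) M (W S (p S))
        = (\<Prod>i\<in>S. ?r i a) *s W S (p S) + ((- 1) ^ card S * (\<Prod>i\<in>S. ?r i a)) *s ?e (W S (q S))
          - (\<Sum>i\<in>S. c i S *s ?e (W (S - {i}) (q (S - {i}))))"
      by (simp add: scale_right_distrib mult.commute)
    moreover have "(- 1) ^ card S * (\<Prod>i\<in>S. ?r i a) = (\<Prod>i\<in>S. ?r a i)"
      by (simp add: cauchy_ratio_swap[of x a] prod_uminus)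
    ultimately show ?thesis
      by (simp add: lin_simps[OF lin_vertex] scale_right_distrib scale_right_diff_distrib
          scale_sum_right)
  qed
  \<comment> \<open>regroup the terms in which some \<open>x\<^sub>i\<close> has been replaced by \<open>x\<^sub>a\<close>\<close>
  have regroup: "(\<Sum>S\<in>Pow X. \<Sum>i\<in>S. (g S * c i S) *s ?e (W (S - {i}) (q (S - {i}))))
      = (\<Sum>T\<in>Pow X. (\<Sum>i\<in>X - T. g (insert i T) * c i (insert i T)) *s ?e (W T (q T)))"
  proof -
    have "(\<Sum>(S, i)\<in>Sigma (Pow X) (\<lambda>S. S). (g S * c i S) *s ?e (W (S - {i}) (q (S - {i}))))
        = (\<Sum>(T, i)\<in>Sigma (Pow X) (\<lambda>T. X - T).
            (g (insert i T) * c i (insert i T)) *s ?e (W T (q T)))"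
      by (rule sum.reindex_bij_witness[where i = "\<lambda>(T, i). (insert i T, i)"
            and j = "\<lambda>(S, i). (S - {i}, i)"]) (auto simp: insert_absorb)
    then show ?thesis
      using fin finS by (subst (asm) (1 2) sum.Sigma[symmetric]) (auto simp: scale_sum_left)
  qed
  have coeff: "g T * (\<Prod>i\<in>T. ?r a i) - (\<Sum>i\<in>X - T. g (insert i T) * c i (insert i T))
      = g T * (\<Prod>i\<in>T. ?r a i) * (\<Prod>j\<in>X - T. ?r a j)" if T: "T \<in> Pow X" for T
  proof -
    have fT: "finite T" using finS[OF T] .
    have "g (insert i T) * c i (insert i T)
        = g T * (\<Prod>j\<in>T. ?r a j) * ((1 + ?r i a) * (\<Prod>j\<in>X - T - {i}. ?r i j))"
      if i: "i \<in> X - T" for i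
    proof -
      have [simp]: "insert i T - {i} = T" "X - insert i T = X - T - {i}" using i by auto
      have "X - T = insert i (X - T - {i})" using i by auto
      then have "g T = (\<Prod>k\<in>T. ?r k i * (\<Prod>j\<in>X - T - {i}. ?r k j))"
        unfolding g_def using fin i by (metis (no_types, lifting) finite_Diff prod.remove)
      then have gT: "g T = (\<Prod>k\<in>T. ?r k i) * (\<Prod>k\<in>T. \<Prod>j\<in>X - T - {i}. ?r k j)"
        by (simp add: prod.distrib)
      have gi: "g (insert i T) = (\<Prod>j\<in>X - T - {i}. ?r i j) * (\<Prod>k\<in>T. \<Prod>j\<in>X - T - {i}. ?r k j)"
        unfolding g_def using i fT by simp
      have "(\<Prod>j\<in>T. ?r j a * ?r i j) = (\<Prod>j\<in>T. ?r a j) * (\<Prod>j\<in>T. ?r j i)"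
        unfolding prod.distrib[symmetric]
        by (rule prod.cong) (simp_all add: cauchy_ratio_swap[of x a] cauchy_ratio_swap[of x i])
      then show ?thesis by (simp add: c_def gT gi mult_ac)
    qed
    then have "(\<Sum>i\<in>X - T. g (insert i T) * c i (insert i T))
        = g T * (\<Prod>j\<in>T. ?r a j) * (\<Sum>i\<in>X - T. (1 + ?r i a) * (\<Prod>j\<in>X - T - {i}. ?r i j))"
      by (simp add: sum_distrib_left)
    also have "(\<Sum>i\<in>X - T. (1 + ?r i a) * (\<Prod>j\<in>X - T - {i}. ?r i j))
        = 1 - (\<Prod>j\<in>X - T. ?r a j)"
      using partial_fractions_cauchy_ratio[of "X - T" x a] fin inj a by (auto simp: inj_on_def)
    finally show ?thesis by (simp add: algebra_simps)
  qed
  have "vertex (x a) M (subset_expansion M x X) = (\<Sum>S\<in>Pow X. vertex (x a) M (g S *s W S (p S)))"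
    by (simp add: subset_expansion_def g_def W_def p_def lin_simps[OF lin_vertex])
  also have "\<dots> = (\<Sum>S\<in>Pow X. (g S * (\<Prod>i\<in>S. ?r i a)) *s W S (p S))
      + (\<Sum>S\<in>Pow X. (g S * (\<Prod>i\<in>S. ?r a i)) *s ?e (W S (q S)))
      - (\<Sum>S\<in>Pow X. \<Sum>i\<in>S. (g S * c i S) *s ?e (W (S - {i}) (q (S - {i}))))"
    unfolding sum.distrib[symmetric] sum_subtractf[symmetric] by (rule sum.cong[OF refl step])
  also have "\<dots> = (\<Sum>S\<in>Pow X. (g S * (\<Prod>i\<in>S. ?r i a)) *s W S (p S))
      + (\<Sum>S\<in>Pow X. (g S * (\<Prod>i\<in>S. ?r a i) * (\<Prod>j\<in>X - S. ?r a j)) *s ?e (W S (q S)))"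
    unfolding regroup add_diff_eq[symmetric] sum_subtractf[symmetric]
      scale_left_diff_distrib[symmetric]
    by (rule arg_cong2[where f = "(+)", OF refl sum.cong[OF refl]]) (simp only: coeff)
  also have "(\<Sum>S\<in>Pow X. (g S * (\<Prod>i\<in>S. ?r i a)) *s W S (p S))
      = (\<Sum>S\<in>Pow X. (\<Prod>i\<in>S. \<Prod>j\<in>insert a X - S. ?r i j) *s W S (p S))"
  proof (rule sum.cong[OF refl])
    fix S assume S: "S \<in> Pow X"
    then have "insert a X - S = insert a (X - S)" using a by auto
    then show "(g S * (\<Prod>i\<in>S. ?r i a)) *s W S (p S)
        = (\<Prod>i\<in>S. \<Prod>j\<in>insert a X - S. ?r i j) *s W S (p S)"
      using fin a by (simp add: g_def prod.distrib mult.commute)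
  qed
  also have "(\<Sum>S\<in>Pow X. (g S * (\<Prod>i\<in>S. ?r a i) * (\<Prod>j\<in>X - S. ?r a j)) *s ?e (W S (q S)))
      = (\<Sum>S\<in>insert a ` Pow X. (\<Prod>i\<in>S. \<Prod>j\<in>insert a X - S. ?r i j) *s W S (p S))"
  proof (rule sum.reindex_cong[symmetric])
    show "inj_on (insert a) (Pow X)" using a by (auto simp: inj_on_def)
  next
    fix S assume S: "S \<in> Pow X"
    have fS: "finite S" and aS: "a \<notin> S" using finS[OF S] S a by auto
    have [simp]: "insert a X - insert a S = X - S" using a by auto
    have "W (insert a S) (p (insert a S)) = (\<Prod>i\<in>S. ?r a i) *s ?e (W S (q S))"
      unfolding W_def p_def q_def using fS aS by (simp add: E_word_insort)
    then show "(\<Prod>i\<in>insert a S. \<Prod>j\<in>insert a X - insert a S. ?r i j) *s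
          W (insert a S) (p (insert a S))
        = (g S * (\<Prod>i\<in>S. ?r a i) * (\<Prod>j\<in>X - S. ?r a j)) *s ?e (W S (q S))"
      using fS aS by (simp add: g_def mult_ac)
  qed simp
  also have "(\<Sum>S\<in>Pow X. (\<Prod>i\<in>S. \<Prod>j\<in>insert a X - S. ?r i j) *s W S (p S))
      + (\<Sum>S\<in>insert a ` Pow X. (\<Prod>i\<in>S. \<Prod>j\<in>insert a X - S. ?r i j) *s W S (p S))
      = (\<Sum>S\<in>Pow (insert a X). (\<Prod>i\<in>S. \<Prod>j\<in>insert a X - S. ?r i j) *s W S (p S))"
    unfolding Pow_insert using fin a by (subst sum.union_disjoint) auto
  finally show ?thesis by (simp add: subset_expansion_def W_def p_def)
qed

end

section \<open>Expansion into strict partitions\<close>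

primrec inner_ratio :: "('i \<Rightarrow> 'a::field) \<Rightarrow> 'i list \<Rightarrow> 'a"
  where "inner_ratio x [] = 1"
  | "inner_ratio x (i # I) = (\<Prod>j\<in>set I. cauchy_ratio x i j) * inner_ratio x I"

text \<open>
  The values \<open>w(1), \<dots>, w(l)\<close> determine the coset of a permutation \<open>w\<close>,
  so these lists index the sum that defines the \<open>Q\<close>-polynomial.
\<close>

definition injections :: "nat \<Rightarrow> nat \<Rightarrow> nat list set"
  where "injections l n = {I. distinct I \<and> length I = l \<and> set I \<subseteq> {1..n}}"

definition ratio_term :: "nat list \<Rightarrow> nat \<Rightarrow> (nat \<Rightarrow> 'a::field) \<Rightarrow> nat list \<Rightarrow> 'a"
  where "ratio_term \<nu> n x I = prod_list (map (\<lambda>(i, m). x i ^ m) (zip I \<nu>)) * inner_ratio x I *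
    (\<Prod>i\<in>set I. \<Prod>j\<in>{1..n} - set I. cauchy_ratio x i j)"

lemma inner_ratio_upt:
  assumes "inj w" and "a \<le> b"
  shows "inner_ratio x (map w [a..<b]) = (\<Prod>i\<in>{a..<b}. \<Prod>j\<in>{i<..<b}. cauchy_ratio x (w i) (w j))"
  using assms(2)
proof (induction a rule: inc_induct)
  case (step a)
  have "{a<..<b} = set [Suc a..<b]" "{a..<b} = insert a {Suc a..<b}" using step.hyps by auto
  moreover have "(\<Prod>j\<in>w ` {Suc a..<b}. cauchy_ratio x (w a) j)
      = (\<Prod>j\<in>{Suc a..<b}. cauchy_ratio x (w a) (w j))"
    using assms(1) by (simp add: prod.reindex inj_on_subset[OF assms(1)])
  ultimately show ?case using step by (simp add: upt_rec[of a b])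
qed simp

text \<open>
  Among the ratios at \<open>i < j\<close>, those with \<open>j\<close> beyond the length of
  \<open>\<nu>\<close> pair a chosen variable with a variable outside the choice; the others stay
  within the choice.
\<close>

lemma Q_term_eq_ratio_term:
  assumes w: "w permutes {1..n}" and len: "length \<nu> \<le> n"
  shows "Q_term \<nu> n x w = ratio_term \<nu> n x (map w [1..<Suc (length \<nu>)])"
proof -
  let ?r = "cauchy_ratio x" and ?l = "length \<nu>"
  have inj: "inj w" using permutes_inj[OF w] .
  have "prod_list (map (\<lambda>(i, m). x i ^ m) (zip (map w [1..<Suc ?l]) \<nu>))
      = (\<Prod>k\<in>{0..<?l}. x (w (Suc k)) ^ (\<nu> ! k))"
    unfolding prod.list_conv_set_nth by (intro prod.cong) (simp_all del: upt_Suc)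
  also have "\<dots> = (\<Prod>i\<in>{1..?l}. x (w i) ^ (\<nu> ! (i - 1)))"
    by (rule prod.reindex_bij_witness[where i = "\<lambda>i. i - 1" and j = Suc]) auto
  finally have mono: "prod_list (map (\<lambda>(i, m). x i ^ m) (zip (map w [1..<Suc ?l]) \<nu>)) = \<dots>" .
  have "set (map w [1..<Suc ?l]) = w ` {1..?l}" by auto
  moreover have "{1..n} - w ` {1..?l} = w ` {?l<..n}"
  proof -
    have "w ` {1..n} - w ` {1..?l} = w ` ({1..n} - {1..?l})"
      using inj by (simp add: image_set_diff)
    moreover have "{1..n} - {1..?l} = {?l<..n}" by auto
    ultimately show ?thesis using permutes_image[OF w] by simp
  qed
  ultimately have outer: "(\<Prod>i\<in>set (map w [1..<Suc ?l]).
        \<Prod>j\<in>{1..n} - set (map w [1..<Suc ?l]). ?r i j)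
      = (\<Prod>i\<in>{1..?l}. \<Prod>j\<in>{?l<..n}. ?r (w i) (w j))"
    using inj by (simp add: prod.reindex inj_on_subset[OF inj])
  have inner: "inner_ratio x (map w [1..<Suc ?l]) = (\<Prod>i\<in>{1..?l}. \<Prod>j\<in>{i<..?l}. ?r (w i) (w j))"
    by (subst inner_ratio_upt[OF inj])
      (auto intro!: prod.cong simp: atLeastLessThanSuc_atLeastAtMost)
  have "(\<Prod>i\<in>{1..?l}. \<Prod>j\<in>{i<..n}. ?r (w i) (w j))
      = (\<Prod>i\<in>{1..?l}. (\<Prod>j\<in>{i<..?l}. ?r (w i) (w j)) * (\<Prod>j\<in>{?l<..n}. ?r (w i) (w j)))"
  proof (rule prod.cong[OF refl])
    fix i assume "i \<in> {1..?l}"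
    then have "{i<..n} = {i<..?l} \<union> {?l<..n}" using len by auto
    then show "(\<Prod>j\<in>{i<..n}. ?r (w i) (w j))
        = (\<Prod>j\<in>{i<..?l}. ?r (w i) (w j)) * (\<Prod>j\<in>{?l<..n}. ?r (w i) (w j))"
      by (simp add: prod.union_disjoint)
  qed
  then show ?thesis
    unfolding ratio_term_def mono outer inner Q_term_def
    by (simp add: prod.distrib cauchy_ratio_def[symmetric] mult.assoc)
qed

text \<open>
  Two maps with the same fibres have images in bijection.
\<close>

lemma sum_image_cong_kernel:
  assumes "\<And>w w'. w \<in> P \<Longrightarrow> w' \<in> P \<Longrightarrow> f w = f w' \<longleftrightarrow> h w = h w'"
    and "\<And>w. w \<in> P \<Longrightarrow> G (f w) = H (h w)"
  shows "sum G (f ` P) = sum H (h ` P)"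
proof (rule sum.reindex_cong)
  let ?l = "\<lambda>b. f (inv_into P h b)"
  have inv: "inv_into P h (h w) \<in> P" "h (inv_into P h (h w)) = h w" if "w \<in> P" for w
    using that by (auto intro: inv_into_into f_inv_into_f)
  have l: "?l (h w) = f w" if "w \<in> P" for w
    using assms(1)[OF inv(1)[OF that] that] inv(2)[OF that] by simp
  show "inj_on ?l (h ` P)" using assms(1) l by (auto simp: inj_on_def)
  show "f ` P = ?l ` (h ` P)" using l by (auto simp: image_image)
  show "G (?l b) = H b" if "b \<in> h ` P" for b
    using that l assms(2) by auto
qed

lemma ex_permutation_extending:
  assumes "distinct I" and "set I \<subseteq> {1..n}"
  obtains w where "w permutes {1..n}" and "map w [1..<Suc (length I)] = I"
proof -
  let ?l = "length I"
  have le: "?l \<le> n"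
    using card_mono[OF _ assms(2)] distinct_card[OF assms(1)] by simp
  have "card ({1..n} - {1..?l}) = card ({1..n} - set I)"
    using assms le by (simp add: card_Diff_subset distinct_card)
  then obtain h where h: "bij_betw h ({1..n} - {1..?l}) ({1..n} - set I)"
    using finite_same_card_bij[of "{1..n} - {1..?l}" "{1..n} - set I"] by auto
  define w where "w i = (if i \<in> {1..?l} then I ! (i - 1) else if i \<in> {1..n} then h i else i)" for i
  have "bij_betw (\<lambda>i. I ! (i - 1)) {1..?l} (set I)"
  proof -
    have "bij_betw (\<lambda>i. i - 1) {1..?l} {..<?l}"
      by (rule bij_betw_byWitness[where f' = Suc]) auto
    from bij_betw_trans[OF this bij_betw_nth[OF assms(1) refl refl]] show ?thesis
      by (simp add: o_def)
  qed
  then have 1: "bij_betw w {1..?l} (set I)"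
    by (rule bij_betw_cong[THEN iffD1, rotated]) (simp add: w_def)
  have 2: "bij_betw w ({1..n} - {1..?l}) ({1..n} - set I)"
    using h by (rule bij_betw_cong[THEN iffD1, rotated]) (auto simp: w_def)
  have "bij_betw w ({1..?l} \<union> ({1..n} - {1..?l})) (set I \<union> ({1..n} - set I))"
    using 1 2 by (rule bij_betw_combine) auto
  moreover have "{1..?l} \<union> ({1..n} - {1..?l}) = {1..n}" using le by auto
  moreover have "set I \<union> ({1..n} - set I) = {1..n}" using assms by auto
  ultimately have "w permutes {1..n}"
    using le by (intro bij_imp_permutes) (auto simp: w_def)
  moreover have "map w [1..<Suc ?l] = I"
    by (rule nth_equalityI) (auto simp: w_def simp del: upt_Suc)
  ultimately show ?thesis using that by blast
qed

lemma Q_formula_eq_sum_injections: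
  assumes len: "length \<nu> \<le> n"
  shows "Q_formula \<nu> n x = 2 ^ length \<nu> * (\<Sum>I\<in>injections (length \<nu>) n. ratio_term \<nu> n x I)"
proof -
  let ?l = "length \<nu>"
  let ?P = "{w. w permutes {1..n}}" and ?T = "{s. s permutes {?l<..n}}"
  define coset where "coset w = (\<lambda>s. w \<circ> s) ` ?T" for w :: "nat \<Rightarrow> nat"
  define start where "start w = map w [1..<Suc ?l]" for w :: "nat \<Rightarrow> nat"
  have T_sub: "s permutes {1..n}" if "s \<in> ?T" for s
    using that by (auto intro: permutes_subset)
  have start_comp: "start (w \<circ> s) = start w" if "s \<in> ?T" for w s
    unfolding start_def using that by (auto simp: permutes_def simp del: upt_Suc)
  have coset_sub: "coset w \<subseteq> coset w'" if w: "w \<in> ?P" "w' \<in> ?P" and eq: "start w = start w'" for w w'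
  proof -
    let ?s = "inv w' \<circ> w"
    have "?s permutes {1..n}" using w permutes_compose permutes_inv by blast
    moreover have "?s i = i" if "i \<in> {1..?l}" for i
    proof -
      have "w i = w' i" using eq that by (auto simp: start_def simp del: upt_Suc)
      then show ?thesis using w by (simp add: permutes_inverses)
    qed
    ultimately have fixed: "?s i = i" if "i \<notin> {?l<..n}" for i
      using that permutes_not_in[of ?s "{1..n}" i] by (cases "i \<in> {1..?l}") auto
    have s: "?s permutes {?l<..n}"
      using \<open>?s permutes {1..n}\<close> fixed unfolding permutes_def by blast
    show ?thesis unfolding coset_def
    proof (rule image_subsetI)
      fix s assume "s \<in> ?T"
      then have "?s \<circ> s \<in> ?T" using s by (simp add: permutes_compose)
      moreover have "w \<circ> s = w' \<circ> (?s \<circ> s)"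
        using w by (simp add: fun_eq_iff permutes_inverses)
      ultimately show "w \<circ> s \<in> (\<lambda>s. w' \<circ> s) ` ?T" by blast
    qed
  qed
  have kernel: "coset w = coset w' \<longleftrightarrow> start w = start w'" if "w \<in> ?P" "w' \<in> ?P" for w w'
  proof
    assume "coset w = coset w'"
    moreover have "w \<in> coset w" unfolding coset_def
      by (rule image_eqI[where x = id]) (auto simp: permutes_id)
    ultimately show "start w = start w'" using start_comp by (auto simp: coset_def)
  next
    assume "start w = start w'"
    then show "coset w = coset w'"
      using coset_sub[OF that] coset_sub[OF that(2,1)] by auto
  qed
  have "the_elem (Q_term \<nu> n x ` coset w) = ratio_term \<nu> n x (start w)" if "w \<in> ?P" for w
  proof -
    have "Q_term \<nu> n x (w \<circ> s) = ratio_term \<nu> n x (start w)" if s: "s \<in> ?T" for s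
    proof -
      have "w \<circ> s permutes {1..n}" using \<open>w \<in> ?P\<close> T_sub[OF s] by (simp add: permutes_compose)
      from Q_term_eq_ratio_term[OF this len, folded start_def] show ?thesis
        by (simp only: start_comp[OF s])
    qed
    then have "Q_term \<nu> n x ` coset w = (\<lambda>s. ratio_term \<nu> n x (start w)) ` ?T"
      unfolding coset_def image_image by (rule image_cong[OF refl])
    also have "\<dots> = {ratio_term \<nu> n x (start w)}"
    proof -
      have "id \<in> ?T" by (simp add: permutes_id)
      then have "?T \<noteq> {}" by blast
      then show ?thesis by (simp add: image_constant_conv)
    qed
    finally show ?thesis by simp
  qed
  then have "(\<Sum>K\<in>coset ` ?P. the_elem (Q_term \<nu> n x ` K))
      = (\<Sum>I\<in>start ` ?P. ratio_term \<nu> n x I)"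
    by (intro sum_image_cong_kernel kernel)
  moreover have "start ` ?P = injections ?l n"
  proof
    show "start ` ?P \<subseteq> injections ?l n"
    proof (intro image_subsetI)
      fix w assume "w \<in> ?P"
      then have "inj w" "w ` {1..?l} \<subseteq> {1..n}"
        using permutes_inj permutes_in_image len by fastforce+
      then show "start w \<in> injections ?l n"
        using inj_on_subset[OF \<open>inj w\<close> subset_UNIV]
        by (auto simp: injections_def start_def distinct_map simp del: upt_Suc)
    qed
    show "injections ?l n \<subseteq> start ` ?P"
    proof
      fix I assume "I \<in> injections ?l n"
      then have I: "distinct I" "set I \<subseteq> {1..n}" "length I = ?l" by (auto simp: injections_def)
      obtain w where "w permutes {1..n}" "map w [1..<Suc ?l] = I"
        using ex_permutation_extending[OF I(1,2)] unfolding I(3) by blast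
      then show "I \<in> start ` ?P" unfolding start_def by blast
    qed
  qed
  ultimately show ?thesis
    by (simp add: Q_formula_def left_cosets_def coset_def)
qed

lemma finite_box: "finite (box N M)"
proof -
  have "box N M \<subseteq> {\<mu>. set \<mu> \<subseteq> {..M} \<and> length \<mu> \<le> N}" by (auto simp: box_def)
  then show ?thesis by (rule finite_subset) (simp add: finite_lists_length_le)
qed

context neutral_fermion_module
begin

abbreviation mode_word :: "(nat \<Rightarrow> 'a) \<Rightarrow> (nat \<times> nat) list \<Rightarrow> 'v \<Rightarrow> 'v"
  where "mode_word x \<equiv> weighted_word (\<lambda>b c. cauchy_ratio x (fst b) (fst c))
    (\<lambda>(i, m) v. x i ^ m *s \<psi> (int m) v)"

definition psi_word :: "nat list \<Rightarrow> 'v \<Rightarrow> 'v"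
  where "psi_word \<nu> v = foldr (\<lambda>p. \<psi> (int p)) \<nu> v"

lemma lin_mode: "lin ((\<lambda>(i, m) v. x i ^ m *s \<psi> (int m) v) b)"
  by (cases b) (auto intro!: linI simp: psi_simps scale_right_distrib mult.commute)

lemma prod_fst_letters:
  "distinct (map fst zs) \<Longrightarrow> (\<Prod>c\<in>set zs. h (fst c)) = (\<Prod>j\<in>fst ` set zs. h j)"
  by (simp add: prod.reindex distinct_map)

lemma mode_word_eq:
  "distinct (map fst zs) \<Longrightarrow> mode_word x zs v
    = (prod_list (map (\<lambda>(i, m). x i ^ m) zs) * inner_ratio x (map fst zs)) *s psi_word (map snd zs) v"
proof (induction zs)
  case (Cons z zs)
  have "(\<Prod>c\<in>set zs. cauchy_ratio x (fst z) (fst c)) = (\<Prod>j\<in>fst ` set zs. cauchy_ratio x (fst z) j)"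
    using Cons.prems by (intro prod_fst_letters) simp
  then show ?case using Cons by (cases z) (simp add: psi_word_def psi_simps mult_ac)
qed (simp add: psi_word_def)

lemma psi_word_repeated: "0 \<notin> set \<nu> \<Longrightarrow> \<not> distinct \<nu> \<Longrightarrow> psi_word \<nu> v = 0"
proof (induction \<nu>)
  case (Cons p \<nu>)
  have absorb: "\<psi> (int p) (psi_word \<mu> v) = 0" if "p \<in> set \<mu>" "0 \<notin> set \<mu>" "p \<noteq> 0" for \<mu>
    using that
  proof (induction \<mu>)
    case (Cons q \<mu>)
    then show ?case
      using psi_swap[of "int p" "int q" "psi_word \<mu> v"]
      by (cases "p = q") (auto simp: psi_word_def psi_psi_eq_0 psi_simps)
  qed simp
  show ?case
  proof (cases "distinct \<nu>")
    case True
    then show ?thesis using Cons.prems absorb[of \<nu>] by (auto simp: psi_word_def)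
  next
    case False
    then show ?thesis using Cons by (auto simp: psi_word_def psi_simps)
  qed
qed simp

definition lettered :: "nat \<Rightarrow> nat list \<Rightarrow> (nat \<times> nat) list set"
  where "lettered M I = {zs. map fst zs = I \<and> (\<forall>z\<in>set zs. snd z \<in> {1..M})}"

lemma lettered_Cons:
  "lettered M (i # I) = (\<lambda>(m, zs). (i, m) # zs) ` ({1..M} \<times> lettered M I)"
proof -
  have "zs \<in> (\<lambda>(m, zs). (i, m) # zs) ` ({1..M} \<times> lettered M I)" if "zs \<in> lettered M (i # I)" for zs
    using that by (cases zs) (auto simp: lettered_def image_iff)
  then show ?thesis by (auto simp: lettered_def)
qed

lemma finite_lettered: "finite (lettered M I)"
  by (induction I) (simp_all add: lettered_Cons, simp add: lettered_def)

lemma E_word_eq_sum_mode_word: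
  "distinct I \<Longrightarrow> E_word M x I v = (\<Sum>zs\<in>lettered M I. mode_word x zs v)"
proof (induction I)
  case Nil
  have "lettered M [] = {[]}" by (auto simp: lettered_def)
  then show ?case by simp
next
  case (Cons i I)
  have "(\<Sum>zs\<in>lettered M (i # I). mode_word x zs v)
      = (\<Sum>(m, zs)\<in>{1..M} \<times> lettered M I. mode_word x ((i, m) # zs) v)"
    unfolding lettered_Cons by (subst sum.reindex) (auto simp: inj_on_def case_prod_beta)
  also have "\<dots> = (\<Sum>(m, zs)\<in>{1..M} \<times> lettered M I.
      (\<Prod>j\<in>set I. cauchy_ratio x i j) *s x i ^ m *s \<psi> (int m) (mode_word x zs v))"
  proof (rule sum.cong[OF refl], clarify)
    fix m zs assume "zs \<in> lettered M I"
    then have "map fst zs = I" by (simp add: lettered_def)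
    then have "distinct (map fst zs)" "fst ` set zs = set I"
      using Cons.prems by (simp_all flip: set_map)
    then show "mode_word x ((i, m) # zs) v
        = (\<Prod>j\<in>set I. cauchy_ratio x i j) *s x i ^ m *s \<psi> (int m) (mode_word x zs v)"
      using prod_fst_letters[of zs "cauchy_ratio x i"] by simp
  qed
  also have "\<dots> = E_word M x (i # I) v"
  proof -
    have "E_word M x (i # I) v
        = (\<Prod>j\<in>set I. cauchy_ratio x i j) *s E M (x i) (\<Sum>zs\<in>lettered M I. mode_word x zs v)"
      using Cons by simp
    then show ?thesis
      by (simp only: E_def psi_simps scale_sum_right sum.cartesian_product case_prod_unfold)
  qed
  finally show ?case ..
qed

definition matchings :: "nat \<Rightarrow> nat \<Rightarrow> (nat \<times> nat) list set"
  where "matchings N M = {zs. distinct (map fst zs) \<and> distinct (map snd zs) \<and>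
    fst ` set zs \<subseteq> {1..N} \<and> snd ` set zs \<subseteq> {1..M}}"

text \<open>
  The letters of a matching anticommute because all their modes are positive.
\<close>

lemma mode_word_sort_key:
  assumes "zs \<in> matchings N M"
  shows "mode_word x (sort_key k zs) v = mode_word x zs v"
proof (rule weighted_word_sort_key[where L = "{z. snd z \<ge> 1}"])
  show "cauchy_ratio x (fst c) (fst b) = - cauchy_ratio x (fst b) (fst c)" for b c :: "nat \<times> nat"
    by (rule cauchy_ratio_swap)
  show "(case b of (i, m) \<Rightarrow> \<lambda>v. x i ^ m *s \<psi> (int m) v) ((case c of (i, m) \<Rightarrow> \<lambda>v. x i ^ m *s \<psi> (int m) v) u)
      = - (case c of (i, m) \<Rightarrow> \<lambda>v. x i ^ m *s \<psi> (int m) v) ((case b of (i, m) \<Rightarrow> \<lambda>v. x i ^ m *s \<psi> (int m) v) u)"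
    if "b \<in> {z. snd z \<ge> 1}" "c \<in> {z. snd z \<ge> 1}" for b c u
    using that psi_swap[of "int (snd b)" "int (snd c)" u]
    by (auto simp: case_prod_beta psi_simps mult.commute)
  show "distinct zs" using assms by (auto simp: matchings_def distinct_map)
  show "set zs \<subseteq> {z. snd z \<ge> 1}" using assms by (auto simp: matchings_def)
qed (rule lin_mode)

text \<open>
  Expanding \<open>E(x\<^sub>i)\<close> for all \<open>i\<close> in a subset attaches a mode to each
  \<open>i\<close>; words with a repeated mode vanish, and what remains is a matching listed by
  increasing index.
\<close>

lemma subset_expansion_eq_sum_sorted_matchings:
  "subset_expansion M x {1..N} = (\<Sum>zs\<in>{zs \<in> matchings N M. sorted (map fst zs)}.
    (\<Prod>i\<in>fst ` set zs. \<Prod>j\<in>{1..N} - fst ` set zs. cauchy_ratio x i j) *s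
      mode_word x zs (parity_vac (length zs)))"
proof -
  let ?g = "\<lambda>S. \<Prod>i\<in>S. \<Prod>j\<in>{1..N} - S. cauchy_ratio x i j"
  let ?L = "\<lambda>S. {zs \<in> lettered M (sorted_list_of_set S). distinct (map snd zs)}"
  have "subset_expansion M x {1..N} = (\<Sum>S\<in>Pow {1..N}. \<Sum>zs\<in>?L S.
      ?g S *s mode_word x zs (parity_vac (length zs)))"
    unfolding subset_expansion_def
  proof (rule sum.cong[OF refl])
    fix S :: "nat set" assume "S \<in> Pow {1..N}"
    have dist: "distinct (sorted_list_of_set S)" by simp
    have len: "length zs = card S" if "zs \<in> lettered M (sorted_list_of_set S)" for zs
    proof -
      have "length (map fst zs) = length (sorted_list_of_set S)"
        using that by (simp only: lettered_def mem_Collect_eq)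
      then show ?thesis by simp
    qed
    have "E_word M x (sorted_list_of_set S) (parity_vac (card S))
        = (\<Sum>zs\<in>lettered M (sorted_list_of_set S). mode_word x zs (parity_vac (length zs)))"
      unfolding E_word_eq_sum_mode_word[OF dist] by (rule sum.cong) (auto simp: len)
    also have "\<dots> = (\<Sum>zs\<in>?L S. mode_word x zs (parity_vac (length zs)))"
    proof (rule sum.mono_neutral_right)
      show "\<forall>zs\<in>lettered M (sorted_list_of_set S) - ?L S.
          mode_word x zs (parity_vac (length zs)) = 0"
      proof
        fix zs assume "zs \<in> lettered M (sorted_list_of_set S) - ?L S"
        then have "0 \<notin> set (map snd zs)" "\<not> distinct (map snd zs)" "distinct (map fst zs)"
          by (auto simp: lettered_def)
        then show "mode_word x zs (parity_vac (length zs)) = 0"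
          by (simp add: mode_word_eq psi_word_repeated del: set_map)
      qed
    qed (auto simp: finite_lettered)
    finally show "?g S *s E_word M x (sorted_list_of_set S) (parity_vac (card S))
        = (\<Sum>zs\<in>?L S. ?g S *s mode_word x zs (parity_vac (length zs)))"
      by (simp add: scale_sum_right)
  qed
  also have "\<dots> = (\<Sum>(S, zs)\<in>Sigma (Pow {1..N}) ?L.
      ?g S *s mode_word x zs (parity_vac (length zs)))"
    by (rule sum.Sigma) (auto simp: finite_lettered)
  also have "\<dots> = (\<Sum>zs\<in>{zs \<in> matchings N M. sorted (map fst zs)}.
      ?g (fst ` set zs) *s mode_word x zs (parity_vac (length zs)))"
  proof (rule sum.reindex_bij_witness[where i = "\<lambda>zs. (fst ` set zs, zs)" and j = snd], goal_cases)
    case (1 a)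
    then have "finite (fst a)" using finite_subset[of "fst a" "{1..N}"] by auto
    then have "set (map fst (snd a)) = fst a"
      using 1 by (auto simp: lettered_def simp del: set_map)
    then show ?case by (cases a) simp
  next
    case (2 a)
    then have fin: "finite (fst a)" using finite_subset[of "fst a" "{1..N}"] by auto
    have "set (map fst (snd a)) = fst a" "distinct (map fst (snd a))" "sorted (map fst (snd a))"
      using 2 fin by (auto simp: lettered_def simp del: set_map)
    then show ?case using 2 by (force simp: matchings_def lettered_def)
  next
    case (3 zs)
    then show ?case by simp
  next
    case (4 zs)
    then have "sorted_list_of_set (set (map fst zs)) = map fst zs"
      by (intro sorted_list_of_set.idem_if_sorted_distinct) (auto simp: matchings_def)
    then show ?case using 4 by (auto simp: lettered_def matchings_def)
  next
    case (5 a)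
    then have "finite (fst a)" using finite_subset[of "fst a" "{1..N}"] by auto
    then have "set (map fst (snd a)) = fst a"
      using 5 by (auto simp: lettered_def simp del: set_map)
    then show ?case by (cases a) simp
  qed
  finally show ?thesis .
qed

text \<open>
  The matchings are listed by decreasing mode instead of increasing index.  The modes then form
  a strict partition and the indices an arbitrary injection.
\<close>

lemma subset_expansion_eq_sum_Q_formula:
  "subset_expansion M x {1..N} = (\<Sum>\<mu>\<in>box N M.
    (Q_formula \<mu> N x / 2 ^ length \<mu>) *s psi_word \<mu> (parity_vac (length \<mu>)))"
proof -
  define g where "g S = (\<Prod>i\<in>S. \<Prod>j\<in>{1..N} - S. cauchy_ratio x i j)" for S
  define t where "t zs = g (fst ` set zs) *s mode_word x zs (parity_vac (length zs))" for zs
  \<comment> \<open>negation makes an increasing sort list the modes in decreasing order\<close>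
  let ?k = "\<lambda>z :: nat \<times> nat. - int (snd z)"
  let ?A = "{zs \<in> matchings N M. sorted (map fst zs)}"
  let ?B = "{zs \<in> matchings N M. sorted (map ?k zs)}"
  have sort_in: "sort_key k zs \<in> matchings N M" if "zs \<in> matchings N M" for k :: "nat \<times> nat \<Rightarrow> 'k::linorder" and zs
    using that by (auto simp: matchings_def distinct_map)
  have t_sort: "t (sort_key k zs) = t zs" if "zs \<in> matchings N M" for k :: "nat \<times> nat \<Rightarrow> 'k::linorder" and zs
    by (simp add: t_def mode_word_sort_key[OF that])
  have inj: "inj_on fst (set zs)" "inj_on ?k (set zs)" if "zs \<in> matchings N M" for zs
    using that by (auto simp: matchings_def distinct_map inj_on_def)
  have "subset_expansion M x {1..N} = (\<Sum>zs\<in>?A. t zs)"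
    unfolding subset_expansion_eq_sum_sorted_matchings t_def g_def ..
  also have "\<dots> = (\<Sum>zs\<in>?B. t zs)"
  proof (rule sum.reindex_bij_witness[where i = "sort_key fst" and j = "sort_key ?k"], goal_cases)
    case (1 zs)
    then show ?case using inj sort_in by (intro sort_key_inj_key_eq) auto
  next
    case (3 zs)
    then show ?case using inj sort_in by (intro sort_key_inj_key_eq) auto
  qed (auto simp: sort_in t_sort)
  also have "\<dots> = (\<Sum>(\<mu>, I)\<in>Sigma (box N M) (\<lambda>\<mu>. injections (length \<mu>) N).
      ratio_term \<mu> N x I *s psi_word \<mu> (parity_vac (length \<mu>)))"
  proof (rule sum.reindex_bij_witness[where i = "\<lambda>(\<mu>, I). zip I \<mu>"
        and j = "\<lambda>zs. (map snd zs, map fst zs)"], goal_cases)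
    case (1 zs)
    then show ?case by (simp add: zip_map_fst_snd)
  next
    case (2 zs)
    have "length (map fst zs) \<le> N"
    proof -
      have "length (map fst zs) = card (set (map fst zs))"
        using 2 by (intro distinct_card[symmetric]) (auto simp: matchings_def)
      also have "\<dots> \<le> card {1..N}" using 2 by (intro card_mono) (auto simp: matchings_def)
      finally show ?thesis by simp
    qed
    moreover have "sorted_wrt (>) (map snd zs)"
    proof -
      have "sorted_wrt (\<lambda>a b. snd b \<le> snd a) zs" using 2 by (simp add: sorted_map)
      moreover have "distinct (map snd zs)" using 2 by (simp add: matchings_def)
      ultimately show ?thesis
        by (induction zs) (force simp: order.strict_iff_order)+
    qed
    ultimately show ?case
      using 2 by (auto simp: matchings_def box_def strict_partition_def injections_def)
  next
    case (3 b)
    then show ?case by (auto simp: injections_def)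
  next
    case (4 b)
    obtain \<mu> I where b: "b = (\<mu>, I)" by (cases b)
    have len: "length I = length \<mu>" using 4 b by (auto simp: injections_def)
    have sorted: "sorted_wrt (>) \<mu>" using 4 b by (auto simp: box_def strict_partition_def)
    have "distinct \<mu>" using sorted by (induction \<mu>) auto
    moreover have "sorted_wrt (\<ge>) (map snd (zip I \<mu>))"
      using sorted_wrt_mono_rel[OF _ sorted, of "(\<ge>)"] len by simp
    then have "sorted (map ?k (zip I \<mu>))" by (simp add: sorted_wrt_map sorted_map)
    moreover have "fst ` set (zip I \<mu>) = set I" "snd ` set (zip I \<mu>) = set \<mu>"
      using len by (simp_all flip: set_map)
    ultimately show ?case
      using 4 b len
      by (auto simp: matchings_def injections_def box_def strict_partition_def Suc_le_eq)
  next
    case (5 zs)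
    then have "distinct (map fst zs)" by (simp add: matchings_def)
    then show ?case
      by (simp add: t_def g_def ratio_term_def mode_word_eq zip_map_fst_snd mult.commute)
  qed
  also have "\<dots> = (\<Sum>\<mu>\<in>box N M. \<Sum>I\<in>injections (length \<mu>) N.
      ratio_term \<mu> N x I *s psi_word \<mu> (parity_vac (length \<mu>)))"
  proof (rule sum.Sigma[symmetric])
    show "finite (box N M)" by (rule finite_box)
    have "injections l N \<subseteq> {I. set I \<subseteq> {1..N} \<and> length I = l}" for l by (auto simp: injections_def)
    then show "\<forall>\<mu>\<in>box N M. finite (injections (length \<mu>) N)"
      by (auto intro: finite_subset[OF _ finite_lists_length_eq[OF finite_atLeastAtMost]])
  qed
  also have "\<dots> = (\<Sum>\<mu>\<in>box N M.
      (Q_formula \<mu> N x / 2 ^ length \<mu>) *s psi_word \<mu> (parity_vac (length \<mu>)))"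
    by (rule sum.cong) (auto simp: box_def Q_formula_eq_sum_injections scale_sum_left)
  finally show ?thesis .
qed

lemma foldr_vertex_eq_subset_expansion:
  assumes "distinct ks" and "inj_on x (set ks)"
  shows "foldr (\<lambda>k. vertex (x k) M) ks \<Omega> = subset_expansion M x (set ks)"
  using assms by (induction ks) (simp_all add: subset_expansion_empty vertex_subset_expansion)

end

section \<open>The Fock space and its dual as fermion modules\<close>

lemma free_alg_induct [case_names zero single add]:
  fixes p :: "'a::field_char_0 free_alg"
  assumes "P 0" and "\<And>w c. P (Poly_Mapping.single w c)" and "\<And>a b. P a \<Longrightarrow> P b \<Longrightarrow> P (a + b)"
  shows "P p"
proof -
  have "P (\<Sum>w\<in>A. Poly_Mapping.single w (Poly_Mapping.lookup p w))" if "finite A" for A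
    using that by induction (auto intro: assms)
  moreover have "p = (\<Sum>w\<in>Poly_Mapping.keys p. Poly_Mapping.single w (Poly_Mapping.lookup p w))"
    by (rule poly_mapping_eqI)
      (simp add: lookup_sum lookup_single when_def in_keys_iff)
  ultimately show ?thesis by (metis finite_keys)
qed

text \<open>
  Words form a noncommutative monoid, so centrality of the scalars has to be checked on monomials.
\<close>

lemma free_scalar_central: "free_scalar c * p = p * free_scalar c"
  by (induction p rule: free_alg_induct)
    (simp_all add: free_scalar_def mult_single mult.commute distrib_left distrib_right)

lemma scalar_0 [simp]: "scalar 0 = 0"
  by (simp add: scalar.abs_eq zero_fermion_alg.abs_eq free_scalar_def)

lemma scalar_1 [simp]: "scalar 1 = 1"
  by (simp add: scalar.abs_eq one_fermion_alg.abs_eq free_scalar_def)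

lemma scalar_add: "scalar (a + b) = scalar a + scalar b"
  by (simp add: scalar.abs_eq plus_fermion_alg.abs_eq free_scalar_def single_add)

lemma scalar_mult: "scalar (a * b) = scalar a * scalar b"
  by (simp add: scalar.abs_eq times_fermion_alg.abs_eq free_scalar_def mult_single)

lemma scalar_central: "scalar c * a = a * scalar c"
  by (induction a rule: fermion_alg.abs_induct)
    (simp add: scalar.abs_eq times_fermion_alg.abs_eq free_scalar_central)

lemma phi_anticomm: "\<phi> m * \<phi> n + \<phi> n * \<phi> m = scalar (if m + n = 0 then 2 * (- 1) powi m else 0)"
  unfolding scalar.abs_eq \<phi>.abs_eq times_fermion_alg.abs_eq plus_fermion_alg.abs_eq
    fermion_alg.abs_eq_iff relation_eq_def
  using relation_ideal.relator[of 1 m n 1] by (simp add: anticomm_relator_def)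

lemma scalar_uminus: "scalar (- c) = - scalar c"
  using scalar_add[of c "- c"] by (simp add: eq_neg_iff_add_eq_0 add.commute)

lemma scalar_left_commute: "a * (scalar c * b) = scalar c * (a * b)"
  by (metis mult.assoc scalar_central)

lemma scalar_scalar: "scalar a * (scalar b * c) = scalar (a * b) * c"
  by (simp add: scalar_mult mult.assoc)

lemma phi_swap: "m + n \<noteq> 0 \<Longrightarrow> \<phi> m * \<phi> n = - (\<phi> n * \<phi> m)"
  using phi_anticomm[of m n] by (simp add: eq_neg_iff_add_eq_0)

lemma lact_mult: "(a * b) \<rhd> v = a \<rhd> b \<rhd> v"
  by transfer (simp add: vac_eq_def vac_annihilator.zero mult.assoc)

lemma lact_one: "1 \<rhd> v = v"
  by transfer (simp add: vac_eq_def vac_annihilator.zero)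

lemma lact_add_left: "(a + b) \<rhd> v = a \<rhd> v + b \<rhd> v"
  by transfer (simp add: vac_eq_def vac_annihilator.zero algebra_simps)

lemma lact_add_right: "a \<rhd> (u + v) = a \<rhd> u + a \<rhd> v"
  by transfer (simp add: vac_eq_def vac_annihilator.zero algebra_simps)

lemma lact_vac_eq_iff: "a \<rhd> |0\<rangle> = b \<rhd> |0\<rangle> \<longleftrightarrow> a - b \<in> vac_annihilator"
  by transfer (simp add: vac_eq_def)

lemma lact_phi_vac: "m < 0 \<Longrightarrow> \<phi> m \<rhd> |0\<rangle> = 0"
  by transfer (use vac_annihilator.gen[of _ 1] in \<open>simp add: vac_eq_def\<close>)

lemma ract_mult: "v \<lhd> (a * b) = v \<lhd> a \<lhd> b"
  by transfer (simp add: covac_eq_def covac_annihilator.zero mult.assoc)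

lemma ract_one: "v \<lhd> 1 = v"
  by transfer (simp add: covac_eq_def covac_annihilator.zero)

lemma ract_add_left: "(u + v) \<lhd> a = u \<lhd> a + v \<lhd> a"
  by transfer (simp add: covac_eq_def covac_annihilator.zero algebra_simps)

lemma ract_add_right: "v \<lhd> (a + b) = v \<lhd> a + v \<lhd> b"
  by transfer (simp add: covac_eq_def covac_annihilator.zero algebra_simps)

lemma ract_covac_eq_iff: "\<langle>0| \<lhd> a = \<langle>0| \<lhd> b \<longleftrightarrow> a - b \<in> covac_annihilator"
  by transfer (simp add: covac_eq_def)

lemma ract_phi_covac: "m < 0 \<Longrightarrow> \<langle>0| \<lhd> \<phi> (- m) = 0"
  by transfer (use covac_annihilator.gen[of _ 1] in \<open>simp add: covac_eq_def\<close>)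

interpretation fock: neutral_fermion_module "\<lambda>c v. scalar c \<rhd> v" "\<lambda>m v. \<phi> m \<rhd> v" vac
proof
  fix m n :: int and v :: "'a fock"
  show "\<phi> m \<rhd> \<phi> n \<rhd> v + \<phi> n \<rhd> \<phi> m \<rhd> v = scalar (if m + n = 0 then 2 * (- 1) powi m else 0) \<rhd> v"
    by (simp only: lact_mult[symmetric] lact_add_left[symmetric] phi_anticomm)
next
  fix m :: int and c :: 'a and v
  show "\<phi> m \<rhd> scalar c \<rhd> v = scalar c \<rhd> \<phi> m \<rhd> v"
    by (simp only: lact_mult[symmetric] scalar_central)
qed (simp_all add: lact_add_right lact_add_left scalar_add scalar_mult lact_mult lact_one lact_phi_vac)

interpretation dual_fock: neutral_fermion_module
  "\<lambda>c v. v \<lhd> scalar c" "\<lambda>m v. v \<lhd> (scalar ((- 1) powi m) * \<phi> (- m))" covac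
proof
  fix m n :: int and v :: "'a dual_fock"
  have "scalar ((- 1) powi n) * \<phi> (- n) * (scalar ((- 1) powi m) * \<phi> (- m))
      + scalar ((- 1) powi m) * \<phi> (- m) * (scalar ((- 1) powi n) * \<phi> (- n))
    = scalar ((- 1) powi (m + n)) * (\<phi> (- n) * \<phi> (- m) + \<phi> (- m) * \<phi> (- n) :: 'a fermion_alg)"
    by (simp add: power_int_add scalar_scalar mult.assoc distrib_left
        scalar_left_commute[of "\<phi> _"] mult.commute)
  also have "\<dots> = scalar (if m + n = 0 then 2 * (- 1) powi m else 0)"
    unfolding phi_anticomm scalar_mult[symmetric] by (auto simp: add_eq_0_iff)
  finally show "v \<lhd> (scalar ((- 1) powi n) * \<phi> (- n)) \<lhd> (scalar ((- 1) powi m) * \<phi> (- m))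
      + v \<lhd> (scalar ((- 1) powi m) * \<phi> (- m)) \<lhd> (scalar ((- 1) powi n) * \<phi> (- n))
    = v \<lhd> scalar (if m + n = 0 then 2 * (- 1) powi m else 0)"
    by (simp only: ract_mult[symmetric] ract_add_right[symmetric])
next
  fix m :: int and c :: 'a and v :: "'a dual_fock"
  show "v \<lhd> scalar c \<lhd> (scalar ((- 1) powi m) * \<phi> (- m)) = v \<lhd> (scalar ((- 1) powi m) * \<phi> (- m)) \<lhd> scalar c"
    by (simp only: ract_mult[symmetric] scalar_central)
next
  fix m :: int assume "m < 0"
  then show "\<langle>0| \<lhd> (scalar ((- 1) powi m) * \<phi> (- m)) = (0 :: 'a dual_fock)"
    by (simp add: scalar_central ract_mult ract_phi_covac)
      (metis ract_add_left add_cancel_right_right)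
next
  fix a b :: 'a and x :: "'a dual_fock"
  show "x \<lhd> scalar b \<lhd> scalar a = x \<lhd> scalar (a * b)"
    by (metis ract_mult scalar_mult mult.commute)
qed (simp_all add: ract_add_right ract_add_left scalar_add ract_mult ract_one)

text \<open>
  The nilpotent exponential sums over the nonzero powers only, whose exponents can here only be 0 and 1.
\<close>

lemma nilp_exp_eq:
  assumes "a * a = 0"
  shows "nilp_exp a = 1 + (a :: 'a::field_char_0 fermion_alg)"
proof -
  have zero: "a ^ k = 0" if k: "2 \<le> k" for k
  proof -
    obtain j where "k = 2 + j" using le_Suc_ex[OF k] by blast
    then have "a ^ k = (a * a) * a ^ j" by (simp add: mult.assoc)
    then show ?thesis using assms by simp
  qed
  have "{k. a ^ k \<noteq> 0} \<subseteq> {0, 1}"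
  proof
    fix k assume "k \<in> {k. a ^ k \<noteq> 0}"
    then have "\<not> 2 \<le> k" using zero by blast
    then show "k \<in> {0, 1}" by auto
  qed
  then have "nilp_exp a = (\<Sum>k\<in>{0, 1}. scalar (1 / fact k) * a ^ k)"
    unfolding nilp_exp_def by (intro sum.mono_neutral_left) auto
  then show ?thesis by simp
qed

lemma phi_phi_eq_0: "m \<noteq> 0 \<Longrightarrow> \<phi> m * \<phi> m = (0 :: 'a::field_char_0 fermion_alg)"
proof -
  assume m: "m \<noteq> 0"
  have "scalar 2 * (\<phi> m * \<phi> m) = (0 :: 'a fermion_alg)"
    using phi_anticomm[of m m, where 'a = 'a] m scalar_add[of "1::'a" 1] by (simp add: distrib_right)
  then have "scalar (1/2) * (scalar 2 * (\<phi> m * \<phi> m)) = (0 :: 'a fermion_alg)" by simp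
  then show ?thesis by (simp add: scalar_scalar)
qed

lemma phi_0_phi_0: "\<phi> 0 * \<phi> 0 = (1 :: 'a::field_char_0 fermion_alg)"
proof -
  have "scalar 2 * (\<phi> 0 * \<phi> 0) = (scalar 2 :: 'a fermion_alg)"
    using phi_anticomm[of 0 0, where 'a = 'a] scalar_add[of "1::'a" 1] by (simp add: distrib_right)
  then have "scalar (1/2) * (scalar 2 * (\<phi> 0 * \<phi> 0)) = (scalar (1/2) * scalar 2 :: 'a fermion_alg)"
    by simp
  then show ?thesis by (simp add: scalar_scalar flip: scalar_mult)
qed

lemma nilp_exp_bilinear:
  assumes "m + n = 1 \<or> m + n = - 1"
  shows "nilp_exp (scalar c * \<phi> m * \<phi> n) = 1 + scalar c * \<phi> m * (\<phi> n :: 'a::field_char_0 fermion_alg)"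
proof (rule nilp_exp_eq)
  have "\<phi> m * \<phi> n * (\<phi> m * \<phi> n) = - (\<phi> m * \<phi> m * (\<phi> n * \<phi> n) :: 'a fermion_alg)"
  proof -
    have swap: "\<phi> n * \<phi> m = - (\<phi> m * \<phi> n :: 'a fermion_alg)"
      by (rule phi_swap) (use assms in auto)
    have "\<phi> m * \<phi> n * (\<phi> m * \<phi> n) = \<phi> m * (\<phi> n * \<phi> m) * (\<phi> n :: 'a fermion_alg)"
      by (simp add: mult.assoc)
    then show ?thesis unfolding swap by (simp add: mult.assoc)
  qed
  also have "\<dots> = 0" using assms phi_phi_eq_0[of m, where 'a = 'a] phi_phi_eq_0[of n, where 'a = 'a]
    by (cases "m = 0") auto
  finally have "\<phi> m * \<phi> n * (\<phi> m * \<phi> n) = (0 :: 'a fermion_alg)" .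
  moreover have "scalar c * \<phi> m * \<phi> n * (scalar c * \<phi> m * \<phi> n)
      = scalar (c * c) * (\<phi> m * \<phi> n * (\<phi> m * \<phi> n))"
    by (simp add: mult.assoc scalar_mult scalar_left_commute[of "\<phi> _"])
  ultimately show "scalar c * \<phi> m * \<phi> n * (scalar c * \<phi> m * \<phi> n) = (0 :: 'a fermion_alg)" by simp
qed

lemma B_op_lact: "B_op M x \<rhd> v = fock.vertex x M v"
proof -
  have "prod_list (map (\<lambda>j. nilp_exp (scalar (1 / 2 * x * (- 1) powi j) * \<phi> (- j + 1) * \<phi> j)) js) \<rhd> v
      = foldr (fock.hop x) js v" for js
    by (induction js)
      (simp_all add: lact_one lact_mult nilp_exp_bilinear lact_add_left fock.hop_def)
  then show ?thesis unfolding B_op_def by (simp only: fock.foldr_hop)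
qed

lemma C_op_ract: "v \<lhd> C_op M x = dual_fock.vertex x M v"
proof -
  have factor: "w \<lhd> nilp_exp (scalar (1 / 2 * x * (- 1) powi (i - 1)) * \<phi> (- i) * \<phi> (i - 1))
      = dual_fock.hop x i w" for i and w :: "'a dual_fock"
  proof -
    have sign: "(- 1 :: 'a) powi (i - 1) = (- 1) powi i * ((- 1) powi i * (- 1) powi (- i + 1))"
    proof -
      have "(- 1 :: 'a) powi i * (- 1) powi (- i + 1) = - 1" by (simp flip: power_int_add)
      then show ?thesis by (simp add: power_int_diff)
    qed
    have eq: "scalar (1 / 2 * x * (- 1) powi (i - 1)) * \<phi> (- i) * \<phi> (i - 1)
      = scalar ((- 1) powi i) * \<phi> (- i) * (scalar ((- 1) powi (- i + 1)) * \<phi> (- (- i + 1)))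
        * (scalar (1 / 2 * x * (- 1) powi i) :: 'a fermion_alg)"
      unfolding sign
      by (simp add: scalar_central[symmetric] scalar_mult mult.assoc scalar_left_commute[of "\<phi> _"])
        (simp add: scalar_scalar mult_ac flip: mult.assoc scalar_mult)
    have "w \<lhd> nilp_exp (scalar (1 / 2 * x * (- 1) powi (i - 1)) * \<phi> (- i) * \<phi> (i - 1))
        = w + w \<lhd> (scalar (1 / 2 * x * (- 1) powi (i - 1)) * \<phi> (- i) * \<phi> (i - 1))"
      by (subst nilp_exp_bilinear) (auto simp: ract_add_right ract_one)
    then show ?thesis
      unfolding eq dual_fock.hop_def by (simp only: ract_mult)
  qed
  have "w \<lhd> prod_list (map (\<lambda>i. nilp_exp (scalar (1 / 2 * x * (- 1) powi (i - 1)) * \<phi> (- i) * \<phi> (i - 1))) js)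
      = foldr (dual_fock.hop x) (rev js) w" for js and w :: "'a dual_fock"
  proof (induction js arbitrary: w)
    case (Cons j js)
    then show ?case
      by (simp only: list.map prod_list.Cons ract_mult[of w] factor rev.simps foldr_append
          foldr.simps o_apply id_apply)
  qed (simp add: ract_one)
  then show ?thesis unfolding C_op_def by (simp only: dual_fock.foldr_hop)
qed

lemma prod_B_op_vac:
  "prod_list (map (\<lambda>k. B_op M (x k)) ks) \<rhd> |0\<rangle> = foldr (\<lambda>k. fock.vertex (x k) M) ks |0\<rangle>"
  by (induction ks) (simp_all add: lact_one lact_mult B_op_lact)

lemma covac_prod_C_op:
  "\<langle>0| \<lhd> prod_list (map (\<lambda>k. C_op M (x k)) (rev ks)) = foldr (\<lambda>k. dual_fock.vertex (x k) M) ks \<langle>0|"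
  by (induction ks) (simp_all add: ract_one ract_mult C_op_ract)

abbreviation phi_prod :: "int list \<Rightarrow> 'a::field_char_0 fermion_alg"
  where "phi_prod ms \<equiv> prod_list (map \<phi> ms)"

definition parity_modes :: "nat \<Rightarrow> int list"
  where "parity_modes n = (if even n then [] else [0])"

definition ket_modes :: "nat list \<Rightarrow> int list"
  where "ket_modes \<nu> = map int \<nu> @ parity_modes (length \<nu>)"

definition bra_modes :: "nat list \<Rightarrow> int list"
  where "bra_modes \<nu> = parity_modes (length \<nu>) @ map (\<lambda>p. - int p) \<nu>"

lemma ket_eq: "ket \<nu> = phi_prod (ket_modes \<nu>) \<rhd> |0\<rangle>"
  by (simp add: ket_def ket_modes_def parity_modes_def lact_mult lact_one o_def)

lemma bra_eq: "bra \<nu> = \<langle>0| \<lhd> phi_prod (bra_modes \<nu>)"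
  by (simp add: bra_def bra_modes_def parity_modes_def ract_mult ract_one o_def)

text \<open>
  The pairing of the bra and the ket vector of \<open>\<nu>\<close> is this sign times \<open>2 ^
  length \<nu>\<close>.
\<close>

definition bra_sign :: "nat list \<Rightarrow> 'a::field_char_0"
  where "bra_sign \<nu> = (- 1) ^ (sum_list \<nu> + length \<nu> * (length \<nu> - 1) div 2)"

lemma bra_sign_Cons: "bra_sign (p # \<nu>) = (- 1) ^ p * (- 1) ^ length \<nu> * bra_sign \<nu>"
proof -
  have "length (p # \<nu>) * (length (p # \<nu>) - 1) div 2 = length \<nu> + length \<nu> * (length \<nu> - 1) div 2"
    by (cases "length \<nu>") (simp_all add: algebra_simps)
  then show ?thesis by (simp add: bra_sign_def power_add mult_ac)
qed

lemma bra_sign_square: "bra_sign \<nu> * bra_sign \<nu> = 1"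
  by (simp add: bra_sign_def flip: power_add)

lemma phi_prod_move:
  fixes ms :: "int list"
  assumes "\<And>m. m \<in> set ms \<Longrightarrow> n + m \<noteq> 0"
  shows "\<phi> n * phi_prod ms = scalar ((- 1) ^ length ms) * (phi_prod ms * \<phi> n :: 'a::field_char_0 fermion_alg)"
  using assms
proof (induction ms)
  case (Cons m ms)
  have "\<phi> n * (\<phi> m * phi_prod ms) = - (\<phi> m * (\<phi> n * phi_prod ms) :: 'a fermion_alg)"
  proof -
    have swap: "\<phi> n * \<phi> m = - (\<phi> m * \<phi> n :: 'a fermion_alg)"
      by (rule phi_swap) (use Cons.prems in auto)
    show ?thesis unfolding mult.assoc[symmetric] swap by simp
  qed
  then show ?case
    using Cons by (simp add: mult.assoc scalar_uminus scalar_left_commute)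
qed simp

lemma ket_eq_psi_word: "ket \<nu> = fock.psi_word \<nu> (fock.parity_vac (length \<nu>))"
proof -
  have "prod_list (map (\<lambda>p. \<phi> (int p)) \<nu>) \<rhd> v = fock.psi_word \<nu> v" for v :: "'a fock"
    unfolding fock.psi_word_def by (induction \<nu>) (simp_all add: lact_one lact_mult)
  then show ?thesis by (simp add: ket_def fock.parity_vac_def)
qed

text \<open>
  In the dual module the word \<open>\<psi>\<^sub>\<nu>\<^sub>1 \<psi>\<^sub>\<nu>\<^sub>2
  \<dots>\<close> acts from the right in reversed order; restoring the order of the anticommuting
  factors produces \<open>(-1)^(l(l-1)/2)\<close>.
\<close>

lemma bra_eq_psi_word:
  assumes "0 \<notin> set \<nu>"
  shows "bra \<nu> \<lhd> scalar (bra_sign \<nu>) = dual_fock.psi_word \<nu> (dual_fock.parity_vac (length \<nu>))"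
proof -
  have "dual_fock.psi_word \<nu> v = v \<lhd> prod_list (map (\<lambda>p. \<phi> (- int p)) \<nu>) \<lhd> scalar (bra_sign \<nu>)"
    if "0 \<notin> set \<nu>" for v :: "'a dual_fock"
    using that unfolding dual_fock.psi_word_def
  proof (induction \<nu>)
    case Nil
    then show ?case by (simp add: ract_one bra_sign_def)
  next
    case (Cons p \<nu>)
    let ?P = "prod_list (map (\<lambda>p. \<phi> (- int p)) \<nu>) :: 'a fermion_alg"
    have move: "\<phi> (- int p) * ?P = scalar ((- 1) ^ length \<nu>) * (?P * \<phi> (- int p))"
    proof -
      have "- int p + m \<noteq> 0" if "m \<in> set (map (\<lambda>p. - int p) \<nu>)" for m
        using that Cons.prems by auto
      from phi_prod_move[of "map (\<lambda>p. - int p) \<nu>" "- int p", OF this] show ?thesis by (simp add: o_def)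
    qed
    have "(- 1) ^ length \<nu> * (bra_sign (p # \<nu>) :: 'a) = (- 1) ^ p * bra_sign \<nu>"
    proof -
      have "(- 1) ^ length \<nu> * ((- 1) ^ p * (- 1) ^ length \<nu> * bra_sign \<nu>)
          = ((- 1) ^ length \<nu> * (- 1) ^ length \<nu>) * ((- 1) ^ p * (bra_sign \<nu> :: 'a))"
        by (simp only: mult_ac)
      also have "(- 1) ^ length \<nu> * (- 1) ^ length \<nu> = (1 :: 'a)" by (simp flip: power_add)
      finally show ?thesis by (simp add: bra_sign_Cons)
    qed
    then have "\<phi> (- int p) * ?P * scalar (bra_sign (p # \<nu>))
        = scalar ((- 1) ^ p * bra_sign \<nu>) * (?P * \<phi> (- int p))"
      unfolding move scalar_central[symmetric] by (simp add: scalar_scalar mult.commute)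
    also have "\<dots> = ?P * scalar (bra_sign \<nu>) * (scalar ((- 1) ^ p) * \<phi> (- int p))"
      by (simp add: mult.assoc scalar_scalar scalar_left_commute[of ?P] mult.commute)
    finally show ?case
      using Cons by (simp add: ract_mult[symmetric] mult.assoc)
  qed
  moreover have "dual_fock.parity_vac n = (if even n then \<langle>0| else \<langle>0| \<lhd> \<phi> 0 :: 'a dual_fock)" for n
    by (simp add: dual_fock.parity_vac_def)
  ultimately show ?thesis using assms by (simp add: bra_def)
qed

section \<open>A functional separating 1 from the annihilators\<close>

text \<open>
  The Jordan-Wigner sign.  Counting the smaller elements keeps it meaningful for infinite sets, so that
  the representation can live on all functions of sets of natural numbers.
\<close>

definition jw_sign :: "nat \<Rightarrow> nat set \<Rightarrow> 'a::field_char_0"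
  where "jw_sign n S = (- 1) ^ card {k \<in> S. k < n}"

definition create :: "nat \<Rightarrow> (nat set \<Rightarrow> 'a::field_char_0) \<Rightarrow> nat set \<Rightarrow> 'a"
  where "create n F S = (if n \<in> S then jw_sign n S * F (S - {n}) else 0)"

definition annihilate :: "nat \<Rightarrow> (nat set \<Rightarrow> 'a::field_char_0) \<Rightarrow> nat set \<Rightarrow> 'a"
  where "annihilate n F S = (if n \<in> S then 0 else jw_sign n S * F (insert n S))"

lemma jw_sign_insert:
  "m \<notin> S \<Longrightarrow> jw_sign n (insert m S) = (if m < n then - jw_sign n S else jw_sign n S)"
proof -
  assume "m \<notin> S"
  moreover have "{k \<in> insert m S. k < n} = (if m < n then insert m {k \<in> S. k < n} else {k \<in> S. k < n})"
    by auto
  ultimately show ?thesis by (simp add: jw_sign_def)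
qed

lemma jw_sign_remove:
  "m \<in> S \<Longrightarrow> jw_sign n (S - {m}) = (if m < n then - jw_sign n S else jw_sign n S :: 'a::field_char_0)"
  using jw_sign_insert[of m "S - {m}" n, where 'a = 'a] by (auto simp: insert_absorb)

lemma jw_sign_square: "jw_sign n S * jw_sign n S = 1"
  by (simp add: jw_sign_def flip: power_add)

lemma create_create: "create m (create n F) S + create n (create m F) S = 0"
proof (cases "m = n")
  case False
  have "S - {m} - {n} = S - {n} - {m}" by auto
  then show ?thesis using False by (auto simp: create_def jw_sign_remove)
qed (simp add: create_def)

lemma annihilate_annihilate: "annihilate m (annihilate n F) S + annihilate n (annihilate m F) S = 0"
proof (cases "m = n")
  case False
  then show ?thesis by (auto simp: annihilate_def jw_sign_insert insert_commute)
qed (simp add: annihilate_def)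

lemma create_annihilate:
  "create m (annihilate n F) S + annihilate n (create m F) S = (if m = n then F S else 0)"
proof (cases "m = n")
  case True
  then show ?thesis
    using jw_sign_square[of n S]
    by (auto simp: annihilate_def create_def jw_sign_insert jw_sign_remove insert_absorb
        simp flip: mult.assoc)
next
  case False
  then have "insert n (S - {m}) = insert n S - {m}" by auto
  then show ?thesis using False by (auto simp: annihilate_def create_def jw_sign_insert jw_sign_remove)
qed

text \<open>
  For \<open>m = 0\<close> both terms are present: \<open>\<phi>\<^sub>0\<close> is represented by the
  sum of creation and annihilation of the mode 0, whose square is 1.
\<close>

definition fermion_op :: "int \<Rightarrow> (nat set \<Rightarrow> 'a::field_char_0) \<Rightarrow> nat set \<Rightarrow> 'a"
  where "fermion_op m F S = (if m \<ge> 0 then create (nat m) F S else 0)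
    + (if m \<le> 0 then (if m = 0 then 1 else 2 * (- 1) powi m) * annihilate (nat (- m)) F S else 0)"

lemma create_linear:
  "create n (\<lambda>S. c * F S + d * G S) S = c * create n F S + d * create n G S"
  by (simp add: create_def algebra_simps)

lemma annihilate_linear:
  "annihilate n (\<lambda>S. c * F S + d * G S) S = c * annihilate n F S + d * annihilate n G S"
  by (simp add: annihilate_def algebra_simps)

lemma fermion_op_linear:
  "fermion_op m (\<lambda>S. c * F S + d * G S) S = c * fermion_op m F S + d * fermion_op m G S"
  by (simp add: fermion_op_def create_linear annihilate_linear algebra_simps)

text \<open>
  Creation and annihilation operators satisfy the canonical relations, and each
  \<open>\<phi>\<^sub>m\<close> is a combination of one of either kind.
\<close>

lemma fermion_op_anticomm:
  "fermion_op m (fermion_op n F) S + fermion_op n (fermion_op m F) S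
    = (if m + n = 0 then 2 * (- 1) powi m else 0) * F S"
proof -
  \<comment> \<open>the coefficients of the creation part and the annihilation part\<close>
  define a where "a k = (if k \<ge> 0 then 1 else 0 :: 'a)" for k :: int
  define b where "b k = (if k < 0 then 2 * (- 1) powi k else if k = 0 then 1 else 0 :: 'a)" for k :: int
  have op: "fermion_op k G = (\<lambda>S. a k * create (nat k) G S + b k * annihilate (nat (- k)) G S)" for k G
    by (auto simp: fermion_op_def fun_eq_iff a_def b_def)
  have "fermion_op m (fermion_op n F) S + fermion_op n (fermion_op m F) S
    = a m * a n * (create (nat m) (create (nat n) F) S + create (nat n) (create (nat m) F) S)
    + b m * b n * (annihilate (nat (- m)) (annihilate (nat (- n)) F) S
        + annihilate (nat (- n)) (annihilate (nat (- m)) F) S)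
    + a m * b n * (create (nat m) (annihilate (nat (- n)) F) S + annihilate (nat (- n)) (create (nat m) F) S)
    + a n * b m * (create (nat n) (annihilate (nat (- m)) F) S + annihilate (nat (- m)) (create (nat n) F) S)"
    unfolding op create_linear annihilate_linear by (simp add: algebra_simps)
  also have "\<dots> = (a m * b n * (if nat m = nat (- n) then 1 else 0)
      + a n * b m * (if nat n = nat (- m) then 1 else 0)) * F S"
    unfolding create_create annihilate_annihilate create_annihilate by (simp add: algebra_simps)
  also have "a m * b n * (if nat m = nat (- n) then 1 else 0)
      + a n * b m * (if nat n = nat (- m) then 1 else 0) = (if m + n = 0 then 2 * (- 1) powi m else 0)"
  proof (cases m "0 :: int" rule: linorder_cases)
    case less
    then show ?thesis by (auto simp: a_def b_def nat_eq_iff)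
  next
    case equal
    then show ?thesis by (auto simp: a_def b_def nat_eq_iff)
  next
    case greater
    then show ?thesis by (cases "m + n = 0")
      (auto simp: a_def b_def nat_eq_iff add_eq_0_iff power_int_minus_one_minus)
  qed
  finally show ?thesis .
qed

definition word_op :: "word \<Rightarrow> (nat set \<Rightarrow> 'a::field_char_0) \<Rightarrow> nat set \<Rightarrow> 'a"
  where "word_op w F = foldr fermion_op (letters w) F"

lemma word_op_linear:
  "word_op w (\<lambda>S. c * F S + d * G S) S = c * word_op w F S + d * word_op w G S"
proof -
  have "foldr fermion_op ms (\<lambda>S. c * F S + d * G S)
      = (\<lambda>S. c * foldr fermion_op ms F S + d * foldr fermion_op ms G S)" for ms
  proof (induction ms)
    case (Cons m ms)
    show ?case unfolding foldr.simps o_apply Cons.IH by (rule ext) (rule fermion_op_linear)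
  qed simp
  then show ?thesis by (simp add: word_op_def)
qed

lemma word_op_plus: "word_op (u + v) F = word_op u (word_op v F)"
  by (simp add: word_op_def plus_word_def)

lemma word_op_zero: "word_op 0 F = F"
  by (simp add: word_op_def zero_word_def)

lemma word_op_letter: "word_op (Word [m]) F = fermion_op m F"
  by (simp add: word_op_def)

definition vacuum_fun :: "nat set \<Rightarrow> 'a::field_char_0"
  where "vacuum_fun S = (if S = {} then 1 else 0)"

text \<open>
  The vacuum component of a word applied to the vacuum, extended linearly.
\<close>

definition free_vacuum_form :: "'a::field_char_0 free_alg \<Rightarrow> 'a"
  where "free_vacuum_form p = (\<Sum>w\<in>Poly_Mapping.keys p. Poly_Mapping.lookup p w * word_op w vacuum_fun {})"

lemma free_vacuum_form_add: "free_vacuum_form (p + q) = free_vacuum_form p + free_vacuum_form q"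
proof -
  let ?K = "Poly_Mapping.keys p \<union> Poly_Mapping.keys q"
  have ext: "free_vacuum_form r = (\<Sum>w\<in>?K. Poly_Mapping.lookup r w * word_op w vacuum_fun {})"
    if "Poly_Mapping.keys r \<subseteq> ?K" for r :: "'a free_alg"
    unfolding free_vacuum_form_def
    using that by (intro sum.mono_neutral_left) (auto simp: in_keys_iff)
  have "Poly_Mapping.keys (p + q) \<subseteq> ?K" by (rule Poly_Mapping.keys_add)
  then show ?thesis
    using ext[of p] ext[of q] ext[of "p + q"]
    by (simp add: lookup_add distrib_right sum.distrib)
qed

lemma free_vacuum_form_0 [simp]: "free_vacuum_form 0 = 0"
  by (simp add: free_vacuum_form_def)

lemma free_vacuum_form_single:
  "free_vacuum_form (Poly_Mapping.single w c) = c * word_op w vacuum_fun {}"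
  by (simp add: free_vacuum_form_def)

lemma free_vacuum_form_diff: "free_vacuum_form (p - q) = free_vacuum_form p - free_vacuum_form q"
  using free_vacuum_form_add[of "p - q" q] by simp

lemma free_vacuum_form_relator: "free_vacuum_form (u * anticomm_relator m n * v) = 0"
proof (induction u rule: free_alg_induct)
  case (single w c)
  show ?case
  proof (induction v rule: free_alg_induct)
    case (single w' c')
    define G :: "nat set \<Rightarrow> 'a" where "G = word_op w' vacuum_fun"
    define k :: 'a where "k = (if m + n = 0 then 2 * (- 1) powi m else 0)"
    have expand: "Poly_Mapping.single w c * anticomm_relator m n * Poly_Mapping.single w' c'
      = Poly_Mapping.single (w + (Word [m] + (Word [n] + w'))) (c * c')
        + Poly_Mapping.single (w + (Word [n] + (Word [m] + w'))) (c * c')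
        - Poly_Mapping.single (w + w') (c * c' * k)"
      by (simp add: anticomm_relator_def free_gen_def free_scalar_def k_def[symmetric] mult_single
          distrib_left distrib_right left_diff_distrib right_diff_distrib add.assoc mult_ac)
    have "word_op w (\<lambda>S. 1 * fermion_op m (fermion_op n G) S + 1 * fermion_op n (fermion_op m G) S)
        = word_op w (\<lambda>S. k * G S + 0 * G S)"
      using fermion_op_anticomm[of m n G] by (simp add: k_def)
    then have "word_op w (fermion_op m (fermion_op n G)) {} + word_op w (fermion_op n (fermion_op m G)) {}
        = k * word_op w G {}"
      using word_op_linear[of w 1 "fermion_op m (fermion_op n G)" 1 "fermion_op n (fermion_op m G)" "{}"]
        word_op_linear[of w k G 0 G "{}"] by simp
    then have "c * c' * word_op w (fermion_op m (fermion_op n G)) {}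
        + c * c' * word_op w (fermion_op n (fermion_op m G)) {} = c * c' * k * word_op w G {}"
      by (simp flip: distrib_left)
    then show ?case
      unfolding expand
      by (simp add: free_vacuum_form_diff free_vacuum_form_add free_vacuum_form_single
          word_op_plus word_op_letter G_def)
  qed (simp_all add: distrib_left free_vacuum_form_add)
qed (simp_all add: distrib_right free_vacuum_form_add)

lemma free_vacuum_form_cong: "relation_eq p q \<Longrightarrow> free_vacuum_form p = free_vacuum_form q"
proof -
  have "free_vacuum_form r = 0" if "r \<in> relation_ideal" for r :: "'a free_alg"
    using that by induction (simp_all add: free_vacuum_form_relator free_vacuum_form_add)
  then show "relation_eq p q \<Longrightarrow> free_vacuum_form p = free_vacuum_form q"
    unfolding relation_eq_def using free_vacuum_form_diff[of p q] by fastforce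
qed

text \<open>
  The functional vanishes on the relations, so any representative gives its value.
\<close>

definition vacuum_form :: "'a::field_char_0 fermion_alg \<Rightarrow> 'a"
  where "vacuum_form a = free_vacuum_form (rep_fermion_alg a)"

lemma vacuum_form_abs: "vacuum_form (abs_fermion_alg p) = free_vacuum_form p"
  unfolding vacuum_form_def
  by (rule free_vacuum_form_cong) (metis Quotient3_abs_rep Quotient3_fermion_alg fermion_alg.abs_eq_iff)

lemma vacuum_form_add: "vacuum_form (a + b) = vacuum_form a + vacuum_form b"
  by (induction a rule: fermion_alg.abs_induct, induction b rule: fermion_alg.abs_induct)
    (simp add: plus_fermion_alg.abs_eq vacuum_form_abs free_vacuum_form_add)

lemma vacuum_form_0 [simp]: "vacuum_form 0 = 0"
  by (simp add: zero_fermion_alg.abs_eq vacuum_form_abs)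

lemma vacuum_form_diff: "vacuum_form (a - b) = vacuum_form a - vacuum_form b"
  using vacuum_form_add[of "a - b" b] by simp

lemma vacuum_form_scalar_mult: "vacuum_form (scalar c * a) = c * vacuum_form a"
proof (induction a rule: fermion_alg.abs_induct)
  case (1 p)
  have "free_vacuum_form (free_scalar c * p) = c * free_vacuum_form p"
    by (induction p rule: free_alg_induct)
      (simp_all add: free_scalar_def mult_single free_vacuum_form_single distrib_left
        free_vacuum_form_add)
  then show ?case by (simp add: scalar.abs_eq times_fermion_alg.abs_eq vacuum_form_abs)
qed

lemma vacuum_form_1: "vacuum_form 1 = (1 :: 'a::field_char_0)"
proof -
  have "free_vacuum_form (Poly_Mapping.single 0 1) = (1 :: 'a)"
    unfolding free_vacuum_form_single by (simp add: word_op_zero vacuum_fun_def)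
  then show ?thesis by (simp add: one_fermion_alg.abs_eq vacuum_form_abs)
qed

lemma vacuum_form_vac_annihilator: "a \<in> vac_annihilator \<Longrightarrow> vacuum_form a = 0"
proof (induction rule: vac_annihilator.induct)
  case (gen m a)
  have "fermion_op m vacuum_fun = (\<lambda>S. 0 * vacuum_fun S + 0 * (vacuum_fun S :: 'a))"
    using gen by (auto simp: fermion_op_def annihilate_def vacuum_fun_def fun_eq_iff)
  then have kill: "word_op w (fermion_op m vacuum_fun) S = (0 :: 'a)" for w S
    using word_op_linear[of w 0 vacuum_fun 0 vacuum_fun] by simp
  show ?case
  proof (induction a rule: fermion_alg.abs_induct)
    case (1 p)
    have "free_vacuum_form (p * free_gen m) = 0"
      by (induction p rule: free_alg_induct)
        (simp_all add: free_gen_def mult_single free_vacuum_form_single distrib_right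
          free_vacuum_form_add word_op_plus word_op_letter kill)
    then show ?case by (simp add: \<phi>.abs_eq times_fermion_alg.abs_eq vacuum_form_abs)
  qed
qed (simp_all add: vacuum_form_add)

lemma vacuum_form_covac_annihilator: "a \<in> covac_annihilator \<Longrightarrow> vacuum_form a = 0"
proof (induction rule: covac_annihilator.induct)
  case (gen m a)
  then have kill: "fermion_op (- m) F {} = (0 :: 'a)" for F
    by (simp add: fermion_op_def create_def)
  show ?case
  proof (induction a rule: fermion_alg.abs_induct)
    case (1 p)
    have "free_vacuum_form (free_gen (- m) * p) = 0"
      by (induction p rule: free_alg_induct)
        (simp_all add: free_gen_def mult_single free_vacuum_form_single distrib_left
          free_vacuum_form_add word_op_plus word_op_letter kill)
    then show ?case by (simp add: \<phi>.abs_eq times_fermion_alg.abs_eq vacuum_form_abs)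
  qed
qed (simp_all add: vacuum_form_add)

text \<open>
  The relation underlying the vacuum expectation value, kept as a relation so that it can be
  established by adding up reductions before uniqueness of the scalar is invoked.
\<close>

definition reduces_to :: "'a::field_char_0 fermion_alg \<Rightarrow> 'a \<Rightarrow> bool"
  where "reduces_to a c \<longleftrightarrow> (\<exists>u\<in>covac_annihilator. \<exists>v\<in>vac_annihilator. a = u + scalar c + v)"

lemma vacuum_form_reduces_to: "reduces_to a c \<Longrightarrow> vacuum_form a = c"
  using vacuum_form_scalar_mult[of c 1]
  by (auto simp: reduces_to_def vacuum_form_add vacuum_form_vac_annihilator
      vacuum_form_covac_annihilator vacuum_form_1)

text \<open>
  Existence of a reduction is the hypothesis; the vacuum functional makes the scalar unique.
\<close>

lemma vev_eqI: "reduces_to a c \<Longrightarrow> vev a = c"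
  unfolding vev_def reduces_to_def[symmetric]
  by (rule the_equality) (auto dest: vacuum_form_reduces_to)

lemma reduces_to_scalar: "reduces_to (scalar c) c"
  unfolding reduces_to_def
  by (intro bexI[of _ 0]) (auto simp: vac_annihilator.zero covac_annihilator.zero)

lemma reduces_to_vac: "a \<in> vac_annihilator \<Longrightarrow> reduces_to a 0"
  unfolding reduces_to_def by (intro bexI[of _ 0] bexI[of _ a]) (auto simp: covac_annihilator.zero)

lemma reduces_to_covac: "a \<in> covac_annihilator \<Longrightarrow> reduces_to a 0"
  unfolding reduces_to_def by (intro bexI[of _ 0] bexI[of _ a]) (auto simp: vac_annihilator.zero)

lemma reduces_to_add: "reduces_to a c \<Longrightarrow> reduces_to b d \<Longrightarrow> reduces_to (a + b) (c + d)"
proof -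
  assume "reduces_to a c" "reduces_to b d"
  then obtain u v u' v' where *: "u \<in> covac_annihilator" "v \<in> vac_annihilator" "a = u + scalar c + v"
    "u' \<in> covac_annihilator" "v' \<in> vac_annihilator" "b = u' + scalar d + v'"
    unfolding reduces_to_def by blast
  have "a + b = (u + u') + scalar (c + d) + (v + v')" unfolding * by (simp add: scalar_add algebra_simps)
  then show ?thesis unfolding reduces_to_def
    using * covac_annihilator.add vac_annihilator.add by blast
qed

lemma reduces_to_scalar_mult: "reduces_to a c \<Longrightarrow> reduces_to (scalar d * a) (d * c)"
proof -
  assume "reduces_to a c"
  then obtain u v where *: "u \<in> covac_annihilator" "v \<in> vac_annihilator" "a = u + scalar c + v"
    unfolding reduces_to_def by blast
  have "scalar d * a = u * scalar d + scalar (d * c) + scalar d * v"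
    unfolding * by (simp add: scalar_mult distrib_left scalar_central[of d u])
  then show ?thesis unfolding reduces_to_def
    using * covac_annihilator_mult vac_annihilator_mult by blast
qed

lemma reduces_to_sum:
  "(\<And>i. i \<in> I \<Longrightarrow> reduces_to (a i) (c i)) \<Longrightarrow> reduces_to (\<Sum>i\<in>I. a i) (\<Sum>i\<in>I. c i)"
proof (induction I rule: infinite_finite_induct)
  case (insert i I)
  then show ?case by (simp add: reduces_to_add)
qed (use reduces_to_scalar[of 0] in simp_all)

lemma phi_move_right_reduces_to_0:
  assumes "n < 0" and "\<And>m. m \<in> set ms \<Longrightarrow> n + m \<noteq> 0"
  shows "reduces_to (a * (\<phi> n * phi_prod ms)) (0 :: 'a::field_char_0)"
proof -
  have "a * (\<phi> n * phi_prod ms) = scalar ((- 1) ^ length ms) * (a * phi_prod ms * \<phi> n)"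
    using phi_prod_move[of ms n, OF assms(2), where 'a = 'a]
    by (simp add: scalar_left_commute mult.assoc)
  moreover have "reduces_to (a * phi_prod ms * \<phi> n) 0"
    using vac_annihilator.gen[OF assms(1)] by (rule reduces_to_vac)
  ultimately show ?thesis using reduces_to_scalar_mult[of _ 0] by fastforce
qed

lemma phi_move_left_reduces_to_0:
  assumes "n > 0" and "\<And>m. m \<in> set ms \<Longrightarrow> n + m \<noteq> 0"
  shows "reduces_to (phi_prod ms * (\<phi> n * a)) (0 :: 'a::field_char_0)"
proof -
  let ?s = "scalar ((- 1) ^ length ms) :: 'a fermion_alg"
  have one: "?s * ?s = 1" by (simp flip: scalar_mult power_add)
  have "phi_prod ms * (\<phi> n * a) = (?s * ?s) * (phi_prod ms * \<phi> n) * a"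
    unfolding one by (simp add: mult.assoc)
  also have "\<dots> = ?s * (\<phi> n * (phi_prod ms * a))"
    using phi_prod_move[of ms n, OF assms(2), where 'a = 'a] by (simp flip: mult.assoc)
  finally show ?thesis
    using reduces_to_scalar_mult[OF reduces_to_covac[OF covac_annihilator.gen[of "- n" "phi_prod ms * a"]]] assms(1)
    by simp
qed

text \<open>
  Wick's theorem in the case at hand.  If the largest parts differ, the factor of the larger one
  anticommutes with everything between it and the vacuum that kills it.  If they agree, contracting
  the two factors leaves a sign, a factor 2 and the pairing of the remaining parts, because the other
  term of the anticommutator again reaches the vacuum.  The words \<open>ms\<close> and
  \<open>ns\<close> stand for the powers of \<open>\<phi>\<^sub>0\<close> at both ends, which stay the
  same when parts are removed.
\<close>

lemma pairing_reduces_to: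
  assumes "sorted_wrt (>) \<mu>" "sorted_wrt (>) \<nu>" "0 \<notin> set \<mu>" "0 \<notin> set \<nu>"
    and "set ms \<subseteq> {0}" "set ns \<subseteq> {0}" "\<mu> = \<nu> \<Longrightarrow> phi_prod ms * phi_prod ns = (1 :: 'a::field_char_0 fermion_alg)"
  shows "reduces_to (phi_prod ms * (phi_prod (map (\<lambda>p. - int p) \<mu>) * (phi_prod (map int \<nu>) * phi_prod ns)))
    (if \<mu> = \<nu> then bra_sign \<mu> * 2 ^ length \<mu> :: 'a else 0)"
  using assms(1-4,7)
proof (induction \<mu> arbitrary: \<nu>)
  case Nil
  show ?case
  proof (cases \<nu>)
    case Nil
    then show ?thesis using Nil.prems reduces_to_scalar[of 1] by (simp add: bra_sign_def)
  next
    case (Cons n \<nu>')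
    then have n: "int n > 0" using Nil.prems by auto
    then have "int n + k \<noteq> 0" if "k \<in> set ms" for k
      using that assms(5) by auto
    from phi_move_left_reduces_to_0[OF n this, where a = "phi_prod (map int \<nu>') * phi_prod ns"]
    show ?thesis using Cons by (simp add: mult.assoc)
  qed
next
  case (Cons m \<mu>)
  let ?P = "phi_prod (map (\<lambda>p. - int p) \<mu>) :: 'a fermion_alg"
  have m: "m > 0" "\<And>p. p \<in> set \<mu> \<Longrightarrow> 0 < p \<and> p < m" using Cons.prems by (auto intro: Suc_leI gr0I)
  show ?case
  proof (cases "\<nu> = [] \<or> hd \<nu> < m")
    case True
    then have small: "q < m" if "q \<in> set \<nu>" for q
      using that Cons.prems(2) by (cases \<nu>) auto
    have "- int m + k \<noteq> 0" if "k \<in> set (map (\<lambda>p. - int p) \<mu> @ map int \<nu> @ ns)" for k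
      using that m small assms(6) by fastforce
    from phi_move_right_reduces_to_0[where n = "- int m" and a = "phi_prod ms"
        and ms = "map (\<lambda>p. - int p) \<mu> @ map int \<nu> @ ns", OF _ this] m True show ?thesis
      by (auto simp: mult.assoc)
  next
    case False
    then obtain n \<nu>' where \<nu>: "\<nu> = n # \<nu>'" "m \<le> n" by (cases \<nu>) auto
    let ?Q = "phi_prod (map int \<nu>') * phi_prod ns :: 'a fermion_alg"
    have n: "n > 0" "\<And>p. p \<in> set \<nu>' \<Longrightarrow> 0 < p \<and> p < n"
      using Cons.prems \<nu> by (auto intro: Suc_leI gr0I)
    show ?thesis
    proof (cases "m = n")
      case False
      then have "int n + k \<noteq> 0" if "k \<in> set (ms @ map (\<lambda>p. - int p) (m # \<mu>))" for k
        using that m n(1) \<nu>(2) assms(5) by fastforce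
      from phi_move_left_reduces_to_0[where n = "int n" and a = ?Q
            and ms = "ms @ map (\<lambda>p. - int p) (m # \<mu>)", OF _ this] n False \<nu> show ?thesis
        by (auto simp: mult.assoc)
    next
      case True
      have kill: "reduces_to (a * (\<phi> (- int m) * ?Q)) 0" for a
      proof -
        have "- int m + k \<noteq> 0" if "k \<in> set (map int \<nu>' @ ns)" for k
          using that m n True assms(6) by fastforce
        from phi_move_right_reduces_to_0[where n = "- int m" and a = a
            and ms = "map int \<nu>' @ ns", OF _ this] m show ?thesis by simp
      qed
      have "- int m + k \<noteq> 0" if "k \<in> set (map (\<lambda>p. - int p) \<mu>)" for k
        using that m by auto
      then have move: "\<phi> (- int m) * ?P = scalar ((- 1) ^ length \<mu>) * (?P * \<phi> (- int m))"
        using phi_prod_move[of "map (\<lambda>p. - int p) \<mu>" "- int m"] by simp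
      have swap: "\<phi> (- int m) * \<phi> (int m) = (scalar (2 * (- 1) ^ m) - \<phi> (int m) * \<phi> (- int m) :: 'a fermion_alg)"
        using phi_anticomm[of "- int m" "int m", where 'a = 'a]
        by (simp add: power_int_minus_one_minus eq_diff_eq)
      define A where "A = phi_prod ms * (?P * ?Q)"
      define R where "R = phi_prod ms * ?P * \<phi> (int m) * (\<phi> (- int m) * ?Q)"
      have "phi_prod ms * (\<phi> (- int m) * ?P * (\<phi> (int m) * ?Q))
          = scalar ((- 1) ^ length \<mu>) * (phi_prod ms * (?P * ((\<phi> (- int m) * \<phi> (int m)) * ?Q)))"
        unfolding move by (simp add: mult.assoc scalar_left_commute)
      also have "\<dots> = scalar ((- 1) ^ length \<mu> * (2 * (- 1) ^ m)) * A
          + scalar (- ((- 1) ^ length \<mu>)) * R"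
      proof -
        have "phi_prod ms * (?P * ((scalar (2 * (- 1) ^ m) - \<phi> (int m) * \<phi> (- int m)) * ?Q))
            = scalar (2 * (- 1) ^ m) * A - R"
          unfolding A_def R_def left_diff_distrib right_diff_distrib
            scalar_left_commute[of "phi_prod ms"] scalar_left_commute[of ?P] mult.assoc ..
        then show ?thesis
          unfolding swap by (simp add: right_diff_distrib scalar_scalar scalar_uminus)
      qed
      finally have split: "phi_prod ms * (\<phi> (- int m) * ?P * (\<phi> (int m) * ?Q)) = \<dots>" .
      have "reduces_to A (if \<mu> = \<nu>' then bra_sign \<mu> * 2 ^ length \<mu> else 0)"
        unfolding A_def using Cons.prems \<nu> True by (intro Cons.IH) auto
      moreover have "reduces_to R 0" unfolding R_def by (rule kill)
      ultimately have "reduces_to (phi_prod ms * (\<phi> (- int m) * ?P * (\<phi> (int m) * ?Q)))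
          ((- 1) ^ length \<mu> * (2 * (- 1) ^ m) * (if \<mu> = \<nu>' then bra_sign \<mu> * 2 ^ length \<mu> else 0)
            + - ((- 1) ^ length \<mu>) * 0)"
        unfolding split by (intro reduces_to_add reduces_to_scalar_mult)
      then show ?thesis
        using \<nu> True by (auto simp: mult.assoc bra_sign_Cons mult_ac)
    qed
  qed
qed

lemma bra_ket_reduces_to:
  assumes "strict_partition \<mu>" "strict_partition \<nu>"
  shows "reduces_to (phi_prod (bra_modes \<mu>) * phi_prod (ket_modes \<nu>))
    (if \<mu> = \<nu> then bra_sign \<mu> * 2 ^ length \<mu> else 0)"
  unfolding bra_modes_def ket_modes_def map_append prod_list.append mult.assoc
  using assms by (intro pairing_reduces_to)
    (auto simp: strict_partition_def parity_modes_def phi_0_phi_0)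

section \<open>Polynomial dependence on the variables\<close>

lemma poly_fun_line:
  assumes "p \<in> poly_fun n"
  shows "\<exists>P. \<forall>s. p (\<lambda>i. x i + s * of_nat i) = poly P s"
  using assms
proof induction
  case (const c)
  show ?case by (intro exI[of _ "[:c:]"]) simp
next
  case (var i)
  show ?case by (intro exI[of _ "[:x i, of_nat i:]"]) simp
next
  case (add p q)
  then obtain P Q where "\<forall>s. p (\<lambda>i. x i + s * of_nat i) = poly P s"
    "\<forall>s. q (\<lambda>i. x i + s * of_nat i) = poly Q s" by blast
  then show ?case by (intro exI[of _ "P + Q"]) simp
next
  case (mult p q)
  then obtain P Q where "\<forall>s. p (\<lambda>i. x i + s * of_nat i) = poly P s"
    "\<forall>s. q (\<lambda>i. x i + s * of_nat i) = poly Q s" by blast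
  then show ?case by (intro exI[of _ "P * Q"]) simp
qed

text \<open>
  On the line of direction \<open>(1, 2, \<dots>, n)\<close> through \<open>x\<close> all but finitely
  many points have distinct coordinates, so the polynomial in one variable has infinitely many zeros.
\<close>

lemma poly_fun_eq_0:
  fixes p :: "(nat \<Rightarrow> 'a::field_char_0) \<Rightarrow> 'a"
  assumes "p \<in> poly_fun n" and zero: "\<And>x. inj_on x {1..n} \<Longrightarrow> p x = 0"
  shows "p x = 0"
proof -
  obtain P where P: "\<And>s. p (\<lambda>i. x i + s * of_nat i) = poly P s"
    using poly_fun_line[OF assms(1)] by blast
  \<comment> \<open>the parameters at which two coordinates on the line coincide\<close>
  define bad where "bad = (\<lambda>(i, j). (x i - x j) / (of_nat j - of_nat i)) ` ({1..n} \<times> {1..n})"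
  have "poly P s = 0" if s: "s \<notin> bad" for s
  proof -
    have "inj_on (\<lambda>i. x i + s * of_nat i) {1..n}"
    proof (rule inj_onI, rule ccontr)
      fix i j assume ij: "i \<in> {1..n}" "j \<in> {1..n}" "i \<noteq> j"
        and "x i + s * of_nat i = x j + s * of_nat j"
      then have "s = (x i - x j) / (of_nat j - of_nat i)"
        by (simp add: eq_divide_eq algebra_simps)
      then show False using s ij unfolding bad_def by auto
    qed
    then show ?thesis using zero P by metis
  qed
  then have "- bad \<subseteq> {s. poly P s = 0}" by auto
  moreover have "infinite (- bad)"
    unfolding bad_def by (rule Diff_infinite_finite[of _ UNIV, folded Compl_eq_Diff_UNIV])
      (auto simp: infinite_UNIV_char_0)
  ultimately have "P = 0" using poly_roots_finite finite_subset by blast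
  then show ?thesis using P[of 0] by simp
qed

lemma schur_Q_eqI:
  fixes q :: "(nat \<Rightarrow> 'a::field_char_0) \<Rightarrow> 'a"
  assumes "q \<in> poly_fun n" and "\<And>x. inj_on x {1..n} \<Longrightarrow> q x = Q_formula \<nu> n x"
  shows "schur_Q \<nu> n = q"
  unfolding schur_Q_def
proof (rule the_equality)
  fix q' :: "(nat \<Rightarrow> 'a) \<Rightarrow> 'a"
  assume q': "q' \<in> poly_fun n \<and> (\<forall>x. inj_on x {1..n} \<longrightarrow> q' x = Q_formula \<nu> n x)"
  have "(\<lambda>x. q' x + (- 1) * q x) \<in> poly_fun n"
    using q' assms(1) by (intro poly_fun.intros) auto
  then have "q' x + (- 1) * q x = 0" for x
    by (rule poly_fun_eq_0) (use q' assms(2) in auto)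
  then show "q' = q" by (auto simp: fun_eq_iff)
qed (use assms in auto)

context vector_space
begin

text \<open>
  A coordinate with respect to a basis.  It reduces statements on vector-valued polynomials to
  scalar ones.
\<close>

lemma ex_linear_functional_nonzero:
  assumes "u \<noteq> 0"
  obtains L where "\<And>v w. L (v + w) = L v + L w" and "\<And>c v. L (scale c v) = c * L v" and "L u \<noteq> 0"
proof -
  define B where "B = extend_basis {}"
  have B: "independent B" "span B = UNIV"
    unfolding B_def using independent_empty by (rule independent_extend_basis span_extend_basis)+
  have "\<exists>b. representation B u b \<noteq> 0"
  proof (rule ccontr)
    assume "\<nexists>b. representation B u b \<noteq> 0"
    then show False
      using sum_nonzero_representation_eq[OF B(1), of u] B(2) assms by simp
  qed
  then obtain b where "representation B u b \<noteq> 0" by blast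
  then show ?thesis
    using that[of "\<lambda>v. representation B v b"] B
    by (simp add: representation_add representation_scale)
qed

end

context neutral_fermion_module
begin

inductive_set vec_poly_fun :: "nat \<Rightarrow> ((nat \<Rightarrow> 'a) \<Rightarrow> 'v) set" for n
  where
    monom: "p \<in> poly_fun n \<Longrightarrow> (\<lambda>x. p x *s w) \<in> vec_poly_fun n"
  | add: "v \<in> vec_poly_fun n \<Longrightarrow> w \<in> vec_poly_fun n \<Longrightarrow> (\<lambda>x. v x + w x) \<in> vec_poly_fun n"

lemma vec_poly_fun_const: "(\<lambda>x. w) \<in> vec_poly_fun n"
  using vec_poly_fun.monom[OF poly_fun.const[of 1], where w = w] by simp

lemma vec_poly_fun_sum:
  "(\<And>i. i \<in> I \<Longrightarrow> v i \<in> vec_poly_fun n) \<Longrightarrow> (\<lambda>x. \<Sum>i\<in>I. v i x) \<in> vec_poly_fun n"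
  by (induction I rule: infinite_finite_induct)
    (simp_all add: vec_poly_fun_const vec_poly_fun.add)

lemma vec_poly_fun_scale:
  assumes "p \<in> poly_fun n" and "v \<in> vec_poly_fun n"
  shows "(\<lambda>x. p x *s v x) \<in> vec_poly_fun n"
  using assms(2)
  by induction (simp_all add: scale_right_distrib vec_poly_fun.intros poly_fun.mult assms(1))

lemma vec_poly_fun_lin:
  assumes "lin F" and "v \<in> vec_poly_fun n"
  shows "(\<lambda>x. F (v x)) \<in> vec_poly_fun n"
  using assms(2) by induction (simp_all add: lin_simps[OF assms(1)] vec_poly_fun.intros)

lemma poly_fun_functional:
  assumes "\<And>v w. L (v + w) = L v + L w" and "\<And>c v. L (c *s v) = c * L v"
    and "v \<in> vec_poly_fun n"
  shows "(\<lambda>x. L (v x)) \<in> poly_fun n"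
  using assms(3) by induction (simp_all add: assms(1,2) poly_fun.intros)

lemma vec_poly_fun_eq_0:
  assumes "v \<in> vec_poly_fun n" and "\<And>x. inj_on x {1..n} \<Longrightarrow> v x = 0"
  shows "v x = 0"
proof (rule ccontr)
  assume "v x \<noteq> 0"
  then obtain L where L: "\<And>v w. L (v + w) = L v + L w" "\<And>c v. L (c *s v) = c * L v" "L (v x) \<noteq> 0"
    by (rule ex_linear_functional_nonzero) (rule that)
  have "L 0 = 0" using L(2)[of 0 0] by simp
  then have "L (v x) = 0" if "inj_on x {1..n}" for x
    using assms(2)[OF that] by simp
  then have "L (v x) = 0"
    by (rule poly_fun_eq_0[where p = "\<lambda>x. L (v x)", OF poly_fun_functional[OF L(1,2) assms(1)]])
  then show False using L(3) by simp
qed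

lemma vec_poly_fun_vertex:
  assumes "k \<in> {1..n}" and "v \<in> vec_poly_fun n"
  shows "(\<lambda>x. vertex (x k) M (v x)) \<in> vec_poly_fun n"
proof -
  have hop: "(\<lambda>x. hop (x k) j (w x)) \<in> vec_poly_fun n" if "w \<in> vec_poly_fun n" for j w
    unfolding hop_def using assms(1) that
    by (intro vec_poly_fun.add vec_poly_fun_scale vec_poly_fun_lin[OF lin_psi] poly_fun.intros) auto
  show ?thesis using assms(2) by (induction M arbitrary: v) (simp_all add: hop)
qed

lemma vec_poly_fun_foldr_vertex:
  "set ks \<subseteq> {1..n} \<Longrightarrow> (\<lambda>x. foldr (\<lambda>k. vertex (x k) M) ks \<Omega>) \<in> vec_poly_fun n"
  by (induction ks) (simp_all add: vec_poly_fun_const vec_poly_fun_vertex)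

lemma foldr_vertex_eq_sum_Q_formula:
  assumes "inj_on x {1..N}"
  shows "foldr (\<lambda>k. vertex (x k) M) [1..<Suc N] \<Omega> = (\<Sum>\<mu>\<in>box N M.
    (Q_formula \<mu> N x / 2 ^ length \<mu>) *s psi_word \<mu> (parity_vac (length \<mu>)))"
proof -
  have "set [1..<Suc N] = {1..N}" by auto
  then show ?thesis
    using foldr_vertex_eq_subset_expansion[of "[1..<Suc N]" x M] assms
    by (simp only: subset_expansion_eq_sum_Q_formula distinct_upt)
qed

end

text \<open>
  The linear functional that maps \<open>a |0\<rangle>\<close> to \<open>vacuum_form (b * a)\<close>;
  the choice of \<open>a\<close> does not matter because \<open>vacuum_form\<close> vanishes on the
  annihilator of the vacuum, which is a left ideal.
\<close>

definition fock_form :: "'a::field_char_0 fermion_alg \<Rightarrow> 'a fock \<Rightarrow> 'a"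
  where "fock_form b v = vacuum_form (b * rep_fock v)"

lemma fock_form_lact_vac: "fock_form b (a \<rhd> |0\<rangle>) = vacuum_form (b * a)"
proof -
  have "a \<rhd> |0\<rangle> = abs_fock a" by (simp add: vac.abs_eq lact.abs_eq)
  moreover have "vac_eq (rep_fock (abs_fock a)) a"
    by (metis Quotient3_abs_rep Quotient3_fock fock.abs_eq_iff)
  ultimately have "b * rep_fock (a \<rhd> |0\<rangle>) - b * a \<in> vac_annihilator"
    unfolding vac_eq_def by (simp add: vac_annihilator_mult flip: right_diff_distrib)
  then show ?thesis
    using vacuum_form_vac_annihilator[of "b * rep_fock (a \<rhd> |0\<rangle>) - b * a"]
    by (simp add: fock_form_def vacuum_form_diff)
qed

lemma ex_lact_vac: "\<exists>a. v = a \<rhd> |0\<rangle>"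
proof (induction v rule: fock.abs_induct)
  case (1 a)
  show ?case by (rule exI[of _ a]) (simp add: vac.abs_eq lact.abs_eq)
qed

lemma fock_form_add: "fock_form b (v + w) = fock_form b v + fock_form b w"
proof -
  obtain p q where "v = p \<rhd> |0\<rangle>" "w = q \<rhd> |0\<rangle>" using ex_lact_vac by metis
  then show ?thesis
    by (simp add: fock_form_lact_vac distrib_left vacuum_form_add flip: lact_add_left)
qed

lemma fock_form_scale: "fock_form b (scalar c \<rhd> v) = c * fock_form b v"
proof -
  obtain p where "v = p \<rhd> |0\<rangle>" using ex_lact_vac by metis
  then show ?thesis
    by (simp add: fock_form_lact_vac scalar_left_commute vacuum_form_scalar_mult flip: lact_mult)
qed

text \<open>
  The definite description in the definition of the \<open>Q\<close>-polynomial has a referent: the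
  coefficient of a ket vector in \<open>B(x\<^sub>1) \<dots> B(x\<^sub>N) |0\<rangle>\<close> is
  polynomial by construction, and equals the symmetrization formula up to a power of 2 where the
  variables are distinct.
\<close>

lemma schur_Q_box:
  assumes "\<mu> \<in> box N M"
  shows "schur_Q \<mu> N \<in> (poly_fun N :: ((nat \<Rightarrow> 'a::field_char_0) \<Rightarrow> 'a) set)"
    and "inj_on x {1..N} \<Longrightarrow> schur_Q \<mu> N x = Q_formula \<mu> N (x :: nat \<Rightarrow> 'a)"
proof -
  let ?L = "fock_form (phi_prod (bra_modes \<mu>)) :: 'a fock \<Rightarrow> 'a"
  \<comment> \<open>the pairing with the ket vector is \<open>bra_sign \<mu> * 2 ^ length \<mu>\<close>; the power of 2 cancels
    against the normalization of the coefficient, and the sign is its own inverse\<close>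
  define q where "q x = bra_sign \<mu> * ?L (foldr (\<lambda>k. fock.vertex (x k) M) [1..<Suc N] |0\<rangle>)" for x
  have L_ket: "?L (ket \<nu>) = (if \<mu> = \<nu> then bra_sign \<mu> * 2 ^ length \<mu> else 0)" if "\<nu> \<in> box N M" for \<nu>
    unfolding ket_eq fock_form_lact_vac
    using assms that by (intro vacuum_form_reduces_to bra_ket_reduces_to) (auto simp: box_def)
  have L_sum: "?L (\<Sum>i\<in>I. h i) = (\<Sum>i\<in>I. ?L (h i))" if "finite I" for I and h :: "nat list \<Rightarrow> 'a fock"
    using that fock_form_add[of "phi_prod (bra_modes \<mu>)" 0 "0 :: 'a fock"]
    by (induction I) (simp_all add: fock_form_add)
  have "(\<lambda>x. ?L (foldr (\<lambda>k. fock.vertex (x k) M) [1..<Suc N] |0\<rangle>)) \<in> poly_fun N"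
    by (rule fock.poly_fun_functional[OF fock_form_add fock_form_scale fock.vec_poly_fun_foldr_vertex]) auto
  then have "q \<in> poly_fun N" unfolding q_def by (intro poly_fun.mult poly_fun.const)
  moreover have "q x = Q_formula \<mu> N x" if "inj_on x {1..N}" for x
  proof -
    have "?L (foldr (\<lambda>k. fock.vertex (x k) M) [1..<Suc N] |0\<rangle>)
        = (\<Sum>\<nu>\<in>box N M. Q_formula \<nu> N x / 2 ^ length \<nu> * ?L (ket \<nu>))"
      unfolding fock.foldr_vertex_eq_sum_Q_formula[OF that] L_sum[OF finite_box]
        ket_eq_psi_word[symmetric] fock_form_scale ..
    also have "\<dots> = (\<Sum>\<nu>\<in>box N M. if \<mu> = \<nu> then bra_sign \<mu> * Q_formula \<mu> N x else 0)"
      by (rule sum.cong) (auto simp: L_ket)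
    also have "\<dots> = bra_sign \<mu> * Q_formula \<mu> N x"
      using assms finite_box by simp
    finally show ?thesis by (simp add: q_def bra_sign_square flip: mult.assoc)
  qed
  ultimately have eq: "schur_Q \<mu> N = q" and q: "q \<in> poly_fun N" "inj_on x {1..N} \<Longrightarrow> q x = Q_formula \<mu> N x" for x
    by (auto intro: schur_Q_eqI)
  show "schur_Q \<mu> N \<in> (poly_fun N :: ((nat \<Rightarrow> 'a) \<Rightarrow> 'a) set)" using eq q by simp
  show "schur_Q \<mu> N x = Q_formula \<mu> N x" if "inj_on x {1..N}" using eq q that by simp
qed

context neutral_fermion_module
begin

lemma foldr_vertex_eq_sum_schur_Q:
  "foldr (\<lambda>k. vertex (x k) M) [1..<Suc N] \<Omega> = (\<Sum>\<mu>\<in>box N M.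
    (schur_Q \<mu> N x / 2 ^ length \<mu>) *s psi_word \<mu> (parity_vac (length \<mu>)))"
proof -
  define D where "D x = foldr (\<lambda>k. vertex (x k) M) [1..<Suc N] \<Omega> + (\<Sum>\<mu>\<in>box N M.
    (- 1 / 2 ^ length \<mu> * schur_Q \<mu> N x) *s psi_word \<mu> (parity_vac (length \<mu>)))" for x
  have "D \<in> vec_poly_fun N"
    unfolding D_def
    by (intro vec_poly_fun.add vec_poly_fun_foldr_vertex vec_poly_fun_sum vec_poly_fun.monom
        poly_fun.mult poly_fun.const schur_Q_box(1)) auto
  moreover have "D x = 0" if "inj_on x {1..N}" for x
    unfolding D_def foldr_vertex_eq_sum_Q_formula[OF that] sum.distrib[symmetric]
    by (intro sum.neutral ballI) (simp add: schur_Q_box(2)[OF _ that] flip: scale_left_distrib)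
  ultimately have "D x = 0" by (rule vec_poly_fun_eq_0)
  moreover have "(\<Sum>\<mu>\<in>box N M. (- 1 / 2 ^ length \<mu> * schur_Q \<mu> N x) *s psi_word \<mu> (parity_vac (length \<mu>)))
      = - (\<Sum>\<mu>\<in>box N M. (schur_Q \<mu> N x / 2 ^ length \<mu>) *s psi_word \<mu> (parity_vac (length \<mu>)))"
    unfolding sum_negf[symmetric] by (rule sum.cong) simp_all
  ultimately show ?thesis unfolding D_def by (simp only: add_uminus_conv_diff right_minus_eq)
qed

end

section \<open>The expansions and their pairing\<close>

theorem theorem4p2:
  fixes M N :: nat
    and x y :: "nat \<Rightarrow> 'a::field_char_0"
  assumes "0 < M" and "0 < N"
  shows "(prod_list (map (\<lambda>k. B_op M (x k)) [1..<Suc N]) \<rhd> |0\<rangle> =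
      (\<Sum>\<mu>\<in>box N M. scalar (schur_Q \<mu> N x / 2 ^ length \<mu>) \<rhd> ket \<mu>))
    \<and> (\<langle>0| \<lhd> prod_list (map (\<lambda>k. C_op M (x k)) (rev [1..<Suc N])) =
      (\<Sum>\<mu>\<in>box N M. bra \<mu> \<lhd>
        scalar ((- 1) ^ (sum_list \<mu> + length \<mu> * (length \<mu> - 1) div 2) *
          (schur_Q \<mu> N x / 2 ^ length \<mu>))))
    \<and> (vev (prod_list (map (\<lambda>k. C_op M (x k)) (rev [1..<Suc N])) *
        prod_list (map (\<lambda>k. B_op M (y k)) [1..<Suc N])) =
      (\<Sum>\<mu>\<in>box N M. schur_Q \<mu> N x * schur_Q \<mu> N y / 2 ^ length \<mu>))"
proof -
  let ?B = "\<lambda>z. prod_list (map (\<lambda>k. B_op M (z k)) [1..<Suc N]) :: 'a fermion_alg"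
  let ?C = "prod_list (map (\<lambda>k. C_op M (x k)) (rev [1..<Suc N])) :: 'a fermion_alg"
  define c where "c z \<mu> = schur_Q \<mu> N z / 2 ^ length \<mu>" for z :: "nat \<Rightarrow> 'a" and \<mu>
  have ket: "?B z \<rhd> |0\<rangle> = (\<Sum>\<mu>\<in>box N M. scalar (c z \<mu>) \<rhd> ket \<mu>)" for z
    unfolding prod_B_op_vac fock.foldr_vertex_eq_sum_schur_Q ket_eq_psi_word c_def ..
  have bra: "\<langle>0| \<lhd> ?C = (\<Sum>\<mu>\<in>box N M. bra \<mu> \<lhd> scalar (bra_sign \<mu> * c x \<mu>))"
    unfolding covac_prod_C_op dual_fock.foldr_vertex_eq_sum_schur_Q c_def[symmetric]
  proof (rule sum.cong[OF refl])
    fix \<mu> assume "\<mu> \<in> box N M"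
    then have "0 \<notin> set \<mu>" by (auto simp: box_def strict_partition_def)
    show "dual_fock.psi_word \<mu> (dual_fock.parity_vac (length \<mu>)) \<lhd> scalar (c x \<mu>)
        = bra \<mu> \<lhd> scalar (bra_sign \<mu> * c x \<mu>)"
      unfolding bra_eq_psi_word[OF \<open>0 \<notin> set \<mu>\<close>, symmetric] scalar_mult ract_mult[of "bra \<mu>"] ..
  qed
  \<comment> \<open>representatives in the algebra of the two expansions; they differ from the operators by
    elements of one-sided ideals, and in the product each of these is multiplied from the side
    that its ideal admits\<close>
  define K where "K = (\<Sum>\<mu>\<in>box N M. scalar (c y \<mu>) * phi_prod (ket_modes \<mu>))"
  define R where "R = (\<Sum>\<mu>\<in>box N M. scalar (bra_sign \<mu> * c x \<mu>) * phi_prod (bra_modes \<mu>))"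
  have lact_sum: "(\<Sum>\<mu>\<in>box N M. h \<mu>) \<rhd> v = (\<Sum>\<mu>\<in>box N M. h \<mu> \<rhd> v)" for h and v :: "'a fock"
    using finite_box[of N M]
  proof induction
    case empty
    show ?case using lact_add_left[of 0 0 v] by simp
  qed (simp add: lact_add_left)
  have ract_sum: "v \<lhd> (\<Sum>\<mu>\<in>box N M. h \<mu>) = (\<Sum>\<mu>\<in>box N M. v \<lhd> h \<mu>)" for h and v :: "'a dual_fock"
    using finite_box[of N M]
  proof induction
    case empty
    show ?case using ract_add_right[of v 0 0] by simp
  qed (simp add: ract_add_right)
  have "?B y \<rhd> |0\<rangle> = K \<rhd> |0\<rangle>" unfolding ket K_def lact_sum ket_eq lact_mult ..
  then have v: "?B y - K \<in> vac_annihilator" by (simp add: lact_vac_eq_iff)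
  have "\<langle>0| \<lhd> ?C = \<langle>0| \<lhd> R" unfolding bra R_def ract_sum bra_eq scalar_central ract_mult ..
  then have u: "?C - R \<in> covac_annihilator" by (simp add: ract_covac_eq_iff)
  have "R * K = (\<Sum>\<mu>\<in>box N M. \<Sum>\<nu>\<in>box N M. scalar (bra_sign \<mu> * c x \<mu> * c y \<nu>) *
      (phi_prod (bra_modes \<mu>) * phi_prod (ket_modes \<nu>)))"
    unfolding R_def K_def sum_product
    by (simp add: mult.assoc scalar_left_commute[of "phi_prod _"] scalar_scalar)
  moreover have "reduces_to \<dots> (\<Sum>\<mu>\<in>box N M. \<Sum>\<nu>\<in>box N M. bra_sign \<mu> * c x \<mu> * c y \<nu> *
      (if \<mu> = \<nu> then bra_sign \<mu> * 2 ^ length \<mu> else 0))"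
    by (intro reduces_to_sum reduces_to_scalar_mult bra_ket_reduces_to) (auto simp: box_def)
  moreover have "(\<Sum>\<nu>\<in>box N M. bra_sign \<mu> * c x \<mu> * c y \<nu> *
      (if \<mu> = \<nu> then bra_sign \<mu> * 2 ^ length \<mu> else 0)) = schur_Q \<mu> N x * schur_Q \<mu> N y / 2 ^ length \<mu>"
    if "\<mu> \<in> box N M" for \<mu>
  proof -
    have "(\<Sum>\<nu>\<in>box N M. bra_sign \<mu> * c x \<mu> * c y \<nu> * (if \<mu> = \<nu> then bra_sign \<mu> * 2 ^ length \<mu> else 0))
        = (\<Sum>\<nu>\<in>box N M. if \<mu> = \<nu> then (bra_sign \<mu> * bra_sign \<mu>) * (c x \<mu> * c y \<mu> * 2 ^ length \<mu>) else 0)"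
      by (rule sum.cong) auto
    then show ?thesis using that finite_box by (simp add: bra_sign_square c_def)
  qed
  ultimately have "reduces_to (R * K) (\<Sum>\<mu>\<in>box N M. schur_Q \<mu> N x * schur_Q \<mu> N y / 2 ^ length \<mu>)"
    by simp
  moreover have "?C * ?B y = (?C - R) * ?B y + (R * (?B y - K) + R * K)"
    by (simp add: algebra_simps)
  ultimately have "reduces_to (?C * ?B y) (\<Sum>\<mu>\<in>box N M. schur_Q \<mu> N x * schur_Q \<mu> N y / 2 ^ length \<mu>)"
    using reduces_to_add[OF reduces_to_covac[OF covac_annihilator_mult[OF u]]
        reduces_to_add[OF reduces_to_vac[OF vac_annihilator_mult[OF v]]]] by simp
  then show ?thesis
    using ket[of x] bra vev_eqI unfolding c_def bra_sign_def by blast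
qed

end
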